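(* Let $M$ be a solid handlebody (cube with handles) with $g$ handles, and let $S=\partial M$ be its boundary, a surface of genus $g$. Let $\phi$ be a dynamical system on $S$. Then $\phi$ can be extended to a dynamical system $\Phi$ on all of $M$ (that is, $S$ is invariant under $\Phi$ and $\Phi|_S=\phi$) by adding a single equilibrium at the "centre" of $M$ and one in the interior of each handle; i.e. the equilibria of $\Phi$ in $M\setminus S$ are exactly $g+1$ points, one lying in the interior of the central 3-cell of $M$ and exactly one lying in the interior of each of the $g$ handles.
   Context: A dynamical system on a manifold $X$ (possibly with boundary) is a flow $\phi_t$, $t\in\mathbb{R}$, on $X$. An equilibrium is a point $x$ with $\phi_t(x)=x$ for all $t$. A solid handlebody, or cube with handles, with $g$ handles is a compact 3-manifold $M$ obtained from a 3-cell (the central 3-cell) by attaching $g$ one-handles, each homeomorphic to $D^2\times[0,1]$ and attached along $D^2\times\{0,1\}$ to disjoint discs in the boundary of the 3-cell. Equivalently, $M$ contains pairwise disjoint, properly embedded 2-cells $D_1,\dots,D_g$ (one across each handle) which cut $M$ into a 3-cell. Nonorientable handlebodies (such as the solid Klein bottle, $g=1$) are allowed; the genus of $S=\partial M$ is the number $g$ of handles, so $\chi(S)=2(1-g)$. *)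

theory Defs
  imports "HOL-Analysis.Analysis"
begin

text \<open>Spaces are values of type \<^typ>\<open>'a topology\<close>; manifolds are topological.\<close>

definition half_space3 :: "(real^3) set" where
  "half_space3 = {x. 0 \<le> x $ 3}"

definition manifold3_with_boundary :: "'a topology \<Rightarrow> bool" where
  "manifold3_with_boundary X \<longleftrightarrow>
     Hausdorff_space X \<and> second_countable X \<and>
     (\<forall>x \<in> topspace X. \<exists>U V. openin X U \<and> x \<in> U \<and>
        openin (top_of_set half_space3) V \<and>
        subtopology X U homeomorphic_space top_of_set V)"

definition interior3 :: "'a topology \<Rightarrow> 'a set" where
  "interior3 X = {x \<in> topspace X. \<exists>U. openin X U \<and> x \<in> U \<and>
     subtopology X U homeomorphic_space (euclidean :: (real^3) topology)}"

definition boundary3 :: "'a topology \<Rightarrow> 'a set" where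
  "boundary3 X = topspace X - interior3 X"

text \<open>
  \<open>handlebody M g B H\<close>: the 3-manifold \<open>M\<close> is obtained from the 3-cell \<open>B\<close> by attaching
  the one-handles \<open>H 0, \<dots>, H (g - 1)\<close>. The pieces are compact subsets of the Hausdorff space
  \<open>M\<close>, hence closed, so the topology of \<open>M\<close> is automatically the one glued from the pieces.
  Since the handles are pairwise disjoint and each \<open>h\<close> is injective, the \<open>2 * g\<close> attaching discs
  are pairwise disjoint. No orientability is required.
\<close>

definition handlebody :: "'a topology \<Rightarrow> nat \<Rightarrow> 'a set \<Rightarrow> (nat \<Rightarrow> 'a set) \<Rightarrow> bool" where
  "handlebody M g B H \<longleftrightarrow>
     manifold3_with_boundary M \<and> compact_space M \<and>
     B \<subseteq> topspace M \<and> (\<forall>i<g. H i \<subseteq> topspace M) \<and>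
     topspace M = B \<union> (\<Union>i<g. H i) \<and>
     subtopology M B homeomorphic_space top_of_set (cball (0::real^3) 1) \<and>
     disjoint_family_on H {..<g} \<and>
     (\<forall>i<g. \<exists>h. homeomorphic_map
          (top_of_set (cball (0::real^2) 1 \<times> {0..1::real})) (subtopology M (H i)) h \<and>
        B \<inter> H i = h ` (cball 0 1 \<times> {0, 1}) \<and>
        B \<inter> H i \<subseteq> boundary3 (subtopology M B))"

definition flow_on :: "'a topology \<Rightarrow> (real \<Rightarrow> 'a \<Rightarrow> 'a) \<Rightarrow> bool" where
  "flow_on X \<phi> \<longleftrightarrow>
     continuous_map (prod_topology euclideanreal X) X (\<lambda>(t, x). \<phi> t x) \<and>
     (\<forall>x \<in> topspace X. \<phi> 0 x = x) \<and>
     (\<forall>x \<in> topspace X. \<forall>s t. \<phi> (s + t) x = \<phi> s (\<phi> t x))"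

definition equilibria :: "'a topology \<Rightarrow> (real \<Rightarrow> 'a \<Rightarrow> 'a) \<Rightarrow> 'a set" where
  "equilibria X \<phi> = {x \<in> topspace X. \<forall>t. \<phi> t x = x}"

end

(* The handlebody minus its spine (the cores of the handles joined by radii to the centre of the
   ball) is S x (0, 1], with coordinate lam equal to 1 on S and tending to 0 at the spine: the
   collar lines are the hyperbolas of a linear saddle in each handle, continued through the
   attaching discs by the radii of the ball. Moving along these lines gives a partial flow X with
   lam (X c m) = c * lam m, whose only fixed points are the centre of the ball and the saddle points
   of the handles. The extension moves inwards along X with a speed that vanishes on S, and
   simultaneously follows the given flow in the S-coordinate, on a clock that stands still where
   lam < 1/2; near the spine it is therefore a reparametrisation of X. *)

theory Submission
  imports Defs
begin

section \<open>Gluing continuous maps and interior points of 3-manifolds\<close>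

text \<open>Two obstacles shape the construction. The S-coordinate \<open>X (1 / lam m) m\<close>
  need not have a limit at the spine, so following \<open>\<phi>\<close> all the way in could
  destroy continuity. Once the clock has stopped, \<open>\<phi>\<close> drops out, the factors
  \<open>drift\<close> and \<open>1 / lam\<close> merge into \<open>drift_speed\<close>, and the
  resulting formula makes sense on the spine as well. The inward motion is that of the logistic
  equation l' = -l (1 - l): it is at rest on S, where \<open>\<phi>\<close> must be left unchanged,
  and linear to first order at l = 0, so that the spine itself moves by \<open>X (exp (- t))\<close>
  and rests only at the fixed points of \<open>X\<close>. The other obstacle is that everything is
  only topological: the attaching discs are arbitrary embedded discs. That \<open>lam\<close> is
  continuous across their edges, that their interiors are interior points of M, and that
  \<open>lam = 1\<close> is exactly S all rest on invariance of domain. The product S x (0, 1] is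
  never established as a homeomorphism; the extension uses only continuity and the algebraic laws of
  \<open>X\<close> and \<open>lam\<close>.\<close>

lemma continuous_map_open_cover:
  assumes "\<And>x. x \<in> topspace X \<Longrightarrow> \<exists>U. openin X U \<and> x \<in> U \<and> continuous_map (subtopology X U) Y f"
  shows "continuous_map X Y f"
  by (rule pasting_lemma[where I = "{U. openin X U \<and> continuous_map (subtopology X U) Y f}"
        and T = "\<lambda>U. U" and f = "\<lambda>_. f"]) (use assms in auto)

lemma continuous_map_closed_cover:
  assumes "finite \<C>" "topspace X \<subseteq> \<Union>\<C>"
    and "\<And>C. C \<in> \<C> \<Longrightarrow> closedin X C \<and> continuous_map (subtopology X C) Y f"
  shows "continuous_map X Y f"
  by (rule pasting_lemma_closed[where I = \<C> and T = "\<lambda>C. C" and f = "\<lambda>_. f"]) (use assms in auto)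

lemma compact_space_top_of_set: "compact S \<Longrightarrow> compact_space (top_of_set S)"
  by (simp add: compact_space_subtopology)

text \<open>A continuous injection of a compact space into a Hausdorff space is an embedding. With
  \<open>inv_into\<close> as the inverse, coordinates on a piece of M become actual functions on
  M.\<close>

lemma continuous_map_inv_into:
  assumes "compact S" "Hausdorff_space M" "continuous_map (top_of_set S) M f" "inj_on f S"
  shows "continuous_map (subtopology M (f ` S)) (top_of_set S) (inv_into S f)"
proof -
  have sub: "f ` S \<subseteq> topspace M"
    using continuous_map_image_subset_topspace[OF assms(3)] by simp
  have "homeomorphic_map (top_of_set S) (subtopology M (f ` S)) f"
    by (rule continuous_imp_homeomorphic_map)
      (use assms sub in \<open>auto simp: compact_space_top_of_set continuous_map_in_subtopology
        Hausdorff_space_subtopology\<close>)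
  then obtain h where h: "homeomorphic_maps (top_of_set S) (subtopology M (f ` S)) f h"
    by (auto simp: homeomorphic_map_maps)
  then have "continuous_map (subtopology M (f ` S)) (top_of_set S) h"
    by (simp add: homeomorphic_maps_def)
  then show ?thesis
  proof (rule continuous_map_eq)
    fix x assume "x \<in> topspace (subtopology M (f ` S))"
    then obtain s where "s \<in> S" "x = f s" by auto
    then show "h x = inv_into S f x" using h assms(4) by (simp add: homeomorphic_maps_def)
  qed
qed

lemma closedin_compact_image:
  assumes "compact S" "Hausdorff_space M" "continuous_map (top_of_set S) M f"
    and "closedin (top_of_set S) C"
  shows "closedin M (f ` C)"
  using continuous_imp_closed_map[OF assms(3) compact_space_top_of_set[OF assms(1)] assms(2)] assms(4)
  by (simp add: closed_map_def)

lemma continuous_map_compose_top_of_set: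
  assumes "continuous_map (top_of_set S) M f" "continuous_on D h" "h ` D \<subseteq> S"
  shows "continuous_map (top_of_set D) M (\<lambda>z. f (h z))"
proof -
  have "continuous_map (top_of_set D) (top_of_set S) h"
    using assms(2,3) by (auto simp: continuous_map_in_subtopology)
  from continuous_map_compose[OF this assms(1)] show ?thesis by (simp add: o_def)
qed

lemma continuous_on_inv_into_compose:
  assumes "compact S" "Hausdorff_space M" "continuous_map (top_of_set S) M f" "inj_on f S"
    and "continuous_map (top_of_set D) M h" "\<And>z. z \<in> D \<Longrightarrow> h z \<in> f ` S"
  shows "continuous_on D (\<lambda>z. inv_into S f (h z))"
proof -
  have "continuous_map (top_of_set D) (subtopology M (f ` S)) h"
    using assms(5,6) by (auto simp: continuous_map_in_subtopology)
  from continuous_map_compose[OF this continuous_map_inv_into[OF assms(1-4)]]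
  show ?thesis by (simp add: o_def continuous_map_in_subtopology)
qed

lemma continuous_map_top_of_set_halves:
  fixes p :: "'b::topological_space \<Rightarrow> real"
  assumes "continuous_on D p"
    and "continuous_map (top_of_set {z \<in> D. p z \<le> a}) Y f"
    and "continuous_map (top_of_set {z \<in> D. a \<le> p z}) Y f"
  shows "continuous_map (top_of_set D) Y f"
proof (rule continuous_map_closed_cover)
  have le: "closedin (top_of_set D) {z \<in> D. p z \<le> a}"
    using closedin_continuous_map_preimage[of "top_of_set D" euclideanreal p "{..a}"] assms(1) by simp
  have ge: "closedin (top_of_set D) {z \<in> D. a \<le> p z}"
    using closedin_continuous_map_preimage[of "top_of_set D" euclideanreal p "{a..}"] assms(1) by simp
  fix C assume "C \<in> {{z \<in> D. p z \<le> a}, {z \<in> D. a \<le> p z}}"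
  then show "closedin (top_of_set D) C \<and> continuous_map (subtopology (top_of_set D) C) Y f"
    using le ge assms(2,3) by (auto simp: subtopology_subtopology Int_absorb1)
qed auto

text \<open>Joint continuity in the pair of parameter and point may be tested in the coordinates of
  one compact piece. The set \<open>D\<close> is arbitrary because the domain of the partial flow
  \<open>X\<close> is not a product.\<close>

lemma continuous_map_product_piece:
  assumes "compact S" "Hausdorff_space M" "continuous_map (top_of_set S) M q" "inj_on q S"
    and "continuous_map (top_of_set {(c, v). v \<in> S \<and> (c, q v) \<in> D}) Y (\<lambda>(c, v). f c (q v))"
  shows "continuous_map (subtopology (prod_topology euclideanreal M) (D \<inter> UNIV \<times> q ` S)) Y (\<lambda>(c, m). f c m)"
proof -
  let ?T = "subtopology (prod_topology euclideanreal M) (D \<inter> UNIV \<times> q ` S)"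
  have "continuous_map ?T (subtopology M (q ` S)) snd"
    by (auto simp: continuous_map_in_subtopology intro: continuous_map_from_subtopology continuous_map_snd)
  from continuous_map_compose[OF this continuous_map_inv_into[OF assms(1-4)]]
  have inv: "continuous_map ?T euclidean (\<lambda>z. inv_into S q (snd z))"
    by (simp add: o_def continuous_map_in_subtopology)
  have "continuous_map ?T euclideanreal fst"
    by (intro continuous_map_from_subtopology continuous_map_fst)
  from continuous_map_pairedI[OF this inv]
  have "continuous_map ?T euclidean (\<lambda>z. (fst z, inv_into S q (snd z)))"
    by simp
  moreover have "inv_into S q (snd z) \<in> S" "q (inv_into S q (snd z)) = snd z" "(fst z, snd z) \<in> D"
    if "z \<in> topspace ?T" for z
  proof -
    have "z \<in> D" "snd z \<in> q ` S" using that by (simp_all add: mem_Times_iff)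
    then obtain v where v: "v \<in> S" "snd z = q v" "z \<in> D" by blast
    then show "inv_into S q (snd z) \<in> S" "q (inv_into S q (snd z)) = snd z"
      using assms(4) by simp_all
    show "(fst z, snd z) \<in> D" using \<open>z \<in> D\<close> by simp
  qed
  ultimately have "continuous_map ?T (top_of_set {(c, v). v \<in> S \<and> (c, q v) \<in> D}) (\<lambda>z. (fst z, inv_into S q (snd z)))"
    by (simp add: continuous_map_in_subtopology image_subset_iff)
  from continuous_map_compose[OF this assms(5)] show ?thesis
    by (rule continuous_map_eq) (auto simp: f_inv_into_f)
qed

lemma homeomorphic_imp_homeomorphic_space:
  assumes "S homeomorphic T"
  shows "top_of_set S homeomorphic_space top_of_set T"
proof -
  obtain f h where "homeomorphism S T f h" using assms by (auto simp: homeomorphic_def)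
  then have "homeomorphic_maps (top_of_set S) (top_of_set T) f h"
    by (auto simp: homeomorphism_def homeomorphic_maps_def continuous_map_in_subtopology)
  then show ?thesis by (auto simp: homeomorphic_space_def)
qed

section \<open>Recognising interior points by charts and by invariance of domain\<close>

lemma openin_interior3: "openin M (interior3 M)"
proof (subst openin_subopen, intro ballI)
  fix x assume "x \<in> interior3 M"
  then obtain U where U: "openin M U" "x \<in> U"
      "subtopology M U homeomorphic_space (euclidean :: (real^3) topology)"
    by (auto simp: interior3_def)
  then have "U \<subseteq> interior3 M" using openin_subset[OF U(1)] by (auto simp: interior3_def)
  then show "\<exists>T. openin M T \<and> x \<in> T \<and> T \<subseteq> interior3 M" using U by blast
qed

text \<open>The chart is restricted to a small ball, since a ball is homeomorphic to the whole
  space, which is what \<open>interior3\<close> asks for. The source type is kept general because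
  ball charts live on \<open>real^3\<close> and handle charts on
  \<open>(real^2) \<times> real\<close>.\<close>

lemma open_embedding_interior3:
  fixes f :: "'b::euclidean_space \<Rightarrow> 'a"
  assumes "DIM('b) = 3" "open D" "continuous_map (top_of_set D) M f" "inj_on f D"
    and op: "\<And>W. open W \<Longrightarrow> W \<subseteq> D \<Longrightarrow> openin M (f ` W)"
  shows "f ` D \<subseteq> interior3 M"
proof
  fix x assume "x \<in> f ` D"
  then obtain z where z: "z \<in> D" "x = f z" by blast
  then obtain r where r: "0 < r" "ball z r \<subseteq> D" using \<open>open D\<close> open_contains_ball by blast
  let ?V = "ball z r"
  have V: "openin M (f ` ?V)" using op r by blast
  have "homeomorphic_map (top_of_set ?V) (subtopology M (f ` ?V)) f"
  proof (rule bijective_open_imp_homeomorphic_map)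
    show "continuous_map (top_of_set ?V) (subtopology M (f ` ?V)) f"
      using continuous_map_from_subtopology_mono[OF assms(3) r(2)]
      by (auto simp: continuous_map_in_subtopology)
    show "open_map (top_of_set ?V) (subtopology M (f ` ?V)) f"
      unfolding open_map_def
    proof (intro allI impI)
      fix U assume "openin (top_of_set ?V) U"
      then have "open U" "U \<subseteq> ?V" by (auto simp: openin_open_eq)
      then have "openin M (f ` U)" "f ` U \<subseteq> f ` ?V" using op r by blast+
      then show "openin (subtopology M (f ` ?V)) (f ` U)"
        unfolding openin_subtopology by blast
    qed
    show "f ` topspace (top_of_set ?V) = topspace (subtopology M (f ` ?V))"
      using openin_subset[OF V] by auto
    show "inj_on f (topspace (top_of_set ?V))" using assms(4) r(2) by (simp add: inj_on_subset)
  qed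
  then have "subtopology M (f ` ?V) homeomorphic_space top_of_set ?V"
    using homeomorphic_map_imp_homeomorphic_space homeomorphic_space_sym by blast
  moreover have "?V homeomorphic (UNIV :: (real^3) set)"
    using homeomorphic_trans[OF homeomorphic_ball_UNIV[OF r(1)]] homeomorphic_UNIV_UNIV assms(1) by force
  then have "top_of_set ?V homeomorphic_space (euclidean :: (real^3) topology)"
    using homeomorphic_imp_homeomorphic_space[of ?V "UNIV :: (real^3) set"] by simp
  ultimately have "subtopology M (f ` ?V) homeomorphic_space (euclidean :: (real^3) topology)"
    by (rule homeomorphic_space_trans)
  moreover have "x \<in> f ` ?V" using z r by auto
  ultimately show "x \<in> interior3 M" using V openin_subset[OF V] by (auto simp: interior3_def)
qed

text \<open>A Euclidean neighbourhood in M of \<open>q z\<close>, cut down to \<open>W\<close> and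
  followed by the inverse of \<open>q\<close>, is a continuous injection between spaces of dimension
  three. By invariance of domain its image, which contains \<open>z\<close> and lies in
  \<open>S\<close>, is open. Read contrapositively, this shows that points of M are not
  interior.\<close>

lemma interior3_imp_interior:
  fixes q :: "'b::euclidean_space \<Rightarrow> 'a"
  assumes "DIM('b) = 3" "compact S" "Hausdorff_space M" "continuous_map (top_of_set S) M q" "inj_on q S"
    and "openin M W" "W \<subseteq> q ` S" "z \<in> S" "q z \<in> W" "q z \<in> interior3 M"
  shows "z \<in> interior S"
proof -
  obtain U where U: "openin M U" "q z \<in> U"
      "subtopology M U homeomorphic_space (euclidean :: (real^3) topology)"
    using assms(10) by (auto simp: interior3_def)
  obtain f h where fh: "homeomorphic_maps (subtopology M U) (euclidean :: (real^3) topology) f h"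
    using U(3) by (auto simp: homeomorphic_space_def)
  have U': "topspace (subtopology M U) = U" using openin_subset[OF U(1)] by auto
  let ?V = "f ` (U \<inter> W)"
  have "openin (subtopology M U) (U \<inter> W)" using assms(6) by (simp add: openin_subtopology_Int2)
  moreover have "homeomorphic_map (subtopology M U) euclidean f"
    using fh homeomorphic_map_maps by blast
  ultimately have "openin (euclidean :: (real^3) topology) ?V"
    using homeomorphic_imp_open_map[of "subtopology M U" euclidean f] by (simp add: open_map_def)
  then have V: "open ?V" by simp
  have hf: "h (f x) = x" if "x \<in> U" for x using fh that U' by (simp add: homeomorphic_maps_def)
  have "continuous_map euclidean M h"
    using fh by (simp add: homeomorphic_maps_def continuous_map_in_subtopology)
  then have "continuous_map (top_of_set ?V) M h" by (simp add: continuous_map_from_subtopology)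
  then have "continuous_on ?V (\<lambda>x. inv_into S q (h x))"
    by (rule continuous_on_inv_into_compose[OF assms(2-5)]) (use assms(7) hf in auto)
  moreover have "inj_on (\<lambda>x. inv_into S q (h x)) ?V"
  proof (rule inj_onI)
    fix u v assume "u \<in> ?V" "v \<in> ?V" and eq: "inv_into S q (h u) = inv_into S q (h v)"
    then obtain x y where xy: "x \<in> U \<inter> W" "y \<in> U \<inter> W" "u = f x" "v = f y" by blast
    then have "inv_into S q x = inv_into S q y" using eq hf by simp
    then show "u = v" using xy assms(7) by (metis IntD2 f_inv_into_f subsetD)
  qed
  ultimately have "open ((\<lambda>x. inv_into S q (h x)) ` ?V)"
    using V assms(1) by (intro invariance_of_domain_gen) auto
  moreover have "(\<lambda>x. inv_into S q (h x)) ` ?V \<subseteq> S"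
    using hf assms(7) by (auto intro: inv_into_into)
  moreover have "inv_into S q (h (f (q z))) = z"
    using hf U(2) assms(5,8) by simp
  then have "z \<in> (\<lambda>x. inv_into S q (h x)) ` ?V"
    using U(2) assms(9) by (metis (no_types, lifting) IntI image_eqI)
  ultimately show ?thesis using interiorI by blast
qed

section \<open>A drift towards the spine\<close>

text \<open>\<open>drift\<close> is the time-t map of the logistic equation l' = -l (1 - l). The
  quotient of \<open>drift t l\<close> by \<open>l\<close> gets its own name because it stays finite
  and positive at l = 0, where it equals \<open>exp (- t)\<close>.\<close>

definition drift_speed :: "real \<Rightarrow> real \<Rightarrow> real" where
  "drift_speed t l = 1 / (exp t * (1 - l) + l)"

definition drift :: "real \<Rightarrow> real \<Rightarrow> real" where
  "drift t l = l * drift_speed t l"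

text \<open>The time spent in \<open>l > 1/2\<close> along the drift orbit from \<open>l\<close> up to time \<open>t\<close>: the drift
  multiplies the odds \<open>(1 - l) / l\<close> by \<open>exp t\<close>, and \<open>l > 1/2\<close> means that their logarithm is
  negative. At \<open>l = 1\<close> that logarithm should be \<open>-\<infinity>\<close> (but is \<open>ln 0 = 0\<close>), hence the case distinction.\<close>

definition boundary_clock :: "real \<Rightarrow> real \<Rightarrow> real" where
  "boundary_clock t l =
     (if l = 1 then t else min (t + ln ((1 - l) / l)) 0 - min (ln ((1 - l) / l)) 0)"

lemma drift_denominator_pos:
  assumes "0 \<le> l" "l \<le> (1::real)"
  shows "0 < exp t * (1 - l) + l"
proof (cases "l = 1")
  case False
  then have "0 < exp t * (1 - l)" using assms by simp
  then show ?thesis using assms by linarith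
qed simp

lemma drift_speed_pos: "0 \<le> l \<Longrightarrow> l \<le> 1 \<Longrightarrow> 0 < drift_speed t l"
  using drift_denominator_pos by (simp add: drift_speed_def)

lemma drift_speed_0_right [simp]: "drift_speed t 0 = exp (- t)"
  by (simp add: drift_speed_def exp_minus field_simps)

lemma drift_speed_1_right [simp]: "drift_speed t 1 = 1"
  by (simp add: drift_speed_def)

lemma drift_1_right [simp]: "drift t 1 = 1"
  by (simp add: drift_def)

lemma drift_0_left [simp]: "drift 0 l = l"
  by (simp add: drift_def drift_speed_def)

lemma drift_pos: "0 < l \<Longrightarrow> l \<le> 1 \<Longrightarrow> 0 < drift t l"
  using drift_speed_pos[of l t] by (simp add: drift_def)

lemma one_minus_drift:
  assumes "0 \<le> l" "l \<le> 1"
  shows "1 - drift t l = exp t * (1 - l) * drift_speed t l"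
  using drift_denominator_pos[OF assms, of t] by (simp add: drift_def drift_speed_def field_simps)

lemma drift_le_1: "0 \<le> l \<Longrightarrow> l \<le> 1 \<Longrightarrow> drift t l \<le> 1"
  using one_minus_drift[of l t] drift_speed_pos[of l t]
  by (smt (verit) exp_gt_zero mult_nonneg_nonneg)

lemma drift_less_1: "0 \<le> l \<Longrightarrow> l < 1 \<Longrightarrow> drift t l < 1"
  using one_minus_drift[of l t] drift_speed_pos[of l t]
  by (smt (verit) exp_gt_zero mult_pos_pos)

lemma drift_odds:
  assumes "0 < l" "l \<le> 1"
  shows "(1 - drift t l) / drift t l = exp t * ((1 - l) / l)"
  using one_minus_drift[of l t] drift_speed_pos[of l t] assms by (simp add: drift_def)

text \<open>The odds \<open>(1 - l) / l\<close> determine l, and on them \<open>drift t\<close> is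
  multiplication by \<open>exp t\<close>.\<close>

lemma drift_add:
  assumes "0 < l" "l \<le> 1"
  shows "drift (s + t) l = drift s (drift t l)"
proof -
  have "0 < drift t l" "drift t l \<le> 1"
    using assms by (auto simp: drift_pos drift_le_1)
  then have "(1 - drift s (drift t l)) / drift s (drift t l) =
        (1 - drift (s + t) l) / drift (s + t) l"
    using assms by (simp add: drift_odds exp_add)
  moreover have "0 < drift s (drift t l)" "0 < drift (s + t) l"
    using assms \<open>0 < drift t l\<close> \<open>drift t l \<le> 1\<close> by (auto simp: drift_pos)
  ultimately show ?thesis by (simp add: field_simps)
qed

lemma drift_fixed:
  assumes "0 < l" "l < 1" "drift t l = l"
  shows "t = 0"
proof -
  have "exp t * ((1 - l) / l) = 1 * ((1 - l) / l)"
    using drift_odds[of l t] assms by simp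
  then show ?thesis using assms by simp
qed

text \<open>With u the logarithm of the odds, the clock is the difference of \<open>min u 0\<close>
  between end and start, and \<open>drift t\<close> shifts u by t; the sum telescopes. This cocycle
  law is what makes the extension a flow.\<close>

lemma boundary_clock_add:
  assumes "0 < l" "l \<le> 1"
  shows "boundary_clock (s + t) l = boundary_clock s (drift t l) + boundary_clock t l"
proof (cases "l = 1")
  case False
  then have "drift t l \<noteq> 1" using assms drift_less_1[of l t] by auto
  moreover have "ln ((1 - drift t l) / drift t l) = t + ln ((1 - l) / l)"
    using assms False by (simp only: drift_odds) (subst ln_mult, auto)
  ultimately show ?thesis using False by (simp add: boundary_clock_def algebra_simps)
qed (simp add: boundary_clock_def)

lemma boundary_clock_0_left [simp]: "boundary_clock 0 l = 0"
  by (simp add: boundary_clock_def)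

lemma boundary_clock_1_right [simp]: "boundary_clock t 1 = t"
  by (simp add: boundary_clock_def)

text \<open>For l at most 1/2 the odds are at least 1, so both logarithms are nonnegative and both
  minima vanish.\<close>

lemma boundary_clock_eq_0:
  assumes "0 < l" "l \<le> 1/2" "drift t l \<le> 1/2"
  shows "boundary_clock t l = 0"
proof -
  have "1 \<le> exp t * ((1 - l) / l)"
    using assms drift_pos[of l t] by (subst drift_odds[symmetric]) auto
  moreover have "1 \<le> (1 - l) / l" using assms by simp
  moreover have "ln (exp t * ((1 - l) / l)) = t + ln ((1 - l) / l)"
    using assms by (subst ln_mult) auto
  ultimately have "0 \<le> t + ln ((1 - l) / l)" "0 \<le> ln ((1 - l) / l)"
    by (metis ln_ge_zero)+
  then show ?thesis using assms by (simp add: boundary_clock_def)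
qed

text \<open>Both logarithms are now nonpositive, so the minima differ by t. In this form the clock
  passes continuously through l = 1, where the logarithm has no value of its own.\<close>

lemma boundary_clock_eq_time:
  assumes "1/2 < l" "l \<le> 1" "1/2 < drift t l"
  shows "boundary_clock t l = t"
proof (cases "l = 1")
  case False
  have "exp t * ((1 - l) / l) \<le> 1"
    using assms by (subst drift_odds[symmetric]) auto
  moreover have "(1 - l) / l \<le> 1" using assms by simp
  moreover have "ln (exp t * ((1 - l) / l)) = t + ln ((1 - l) / l)"
    using assms False by (subst ln_mult) auto
  moreover have "0 < exp t * ((1 - l) / l)" "0 < (1 - l) / l" using assms False by auto
  ultimately have "t + ln ((1 - l) / l) \<le> 0" "ln ((1 - l) / l) \<le> 0"
    by (metis ln_le_zero_iff)+
  then show ?thesis using False by (simp add: boundary_clock_def)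
qed simp

lemma continuous_on_drift_speed:
  "continuous_on (UNIV \<times> {0..1}) (\<lambda>z. drift_speed (fst z) (snd z))"
  unfolding drift_speed_def
  by (intro continuous_intros) (use drift_denominator_pos in \<open>force simp: less_imp_neq[symmetric]\<close>)

lemma continuous_on_drift:
  "continuous_on (UNIV \<times> {0..1}) (\<lambda>z. drift (fst z) (snd z))"
  unfolding drift_def by (intro continuous_intros continuous_on_drift_speed)

lemma continuous_on_boundary_clock:
  "continuous_on (UNIV \<times> {0<..1}) (\<lambda>z. boundary_clock (fst z) (snd z))"
proof -
  let ?D = "(UNIV :: real set) \<times> {0<..1::real}"
  let ?U = "{z \<in> ?D. snd z < 1}"
  \<comment> \<open>A neighbourhood of l = 1 on which the clock is simply the time; the formula with
    logarithms serves on \<open>?U\<close>.\<close>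
  let ?V = "{z \<in> ?D. 1/2 < snd z \<and> 1/2 < drift (fst z) (snd z)}"
  have d: "continuous_on ?D (\<lambda>z. drift (fst z) (snd z))"
    by (rule continuous_on_subset[OF continuous_on_drift]) auto
  have U: "openin (top_of_set ?D) ?U"
    using openin_continuous_map_preimage[of "top_of_set ?D" euclideanreal snd "{..<1}"]
    by (simp add: continuous_on_snd)
  have "openin (top_of_set ?D) {z \<in> ?D. snd z \<in> {1/2<..}}"
    using openin_continuous_map_preimage[of "top_of_set ?D" euclideanreal snd "{1/2<..}"]
    by (simp add: continuous_on_snd)
  moreover have "openin (top_of_set ?D) {z \<in> ?D. drift (fst z) (snd z) \<in> {1/2<..}}"
    using openin_continuous_map_preimage[of "top_of_set ?D" euclideanreal "\<lambda>z. drift (fst z) (snd z)" "{1/2<..}"] d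
    by simp
  ultimately have "openin (top_of_set ?D)
      ({z \<in> ?D. snd z \<in> {1/2<..}} \<inter> {z \<in> ?D. drift (fst z) (snd z) \<in> {1/2<..}})"
    by (rule openin_Int)
  also have "\<dots> = ?V" by auto
  finally have V: "openin (top_of_set ?D) ?V" .
  have "continuous_on ?U (\<lambda>z. boundary_clock (fst z) (snd z)) \<longleftrightarrow>
      continuous_on ?U (\<lambda>z. min (fst z + ln ((1 - snd z) / snd z)) 0 - min (ln ((1 - snd z) / snd z)) 0)"
    by (rule continuous_on_cong) (auto simp: boundary_clock_def)
  moreover have "continuous_on ?U (\<lambda>z. min (fst z + ln ((1 - snd z) / snd z)) 0 - min (ln ((1 - snd z) / snd z)) 0)"
    by (intro continuous_intros) auto
  ultimately have cU: "continuous_on ?U (\<lambda>z. boundary_clock (fst z) (snd z))" by blast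
  have cV: "continuous_on ?V (\<lambda>z. boundary_clock (fst z) (snd z))"
    by (subst continuous_on_cong[OF refl, where g = fst])
      (auto simp: boundary_clock_eq_time intro: continuous_on_fst)
  have "continuous_map (top_of_set ?D) euclideanreal (\<lambda>z. boundary_clock (fst z) (snd z))"
  proof (rule continuous_map_open_cover)
    fix z assume z: "z \<in> topspace (top_of_set ?D)"
    \<comment> \<open>At l = 1 the drift stands still, so start and end both exceed 1/2.\<close>
    have "z \<in> ?U \<or> z \<in> ?V"
      using z by (cases "snd z = 1") (auto simp: drift_def)
    then show "\<exists>W. openin (top_of_set ?D) W \<and> z \<in> W \<and>
      continuous_map (subtopology (top_of_set ?D) W) euclideanreal (\<lambda>z. boundary_clock (fst z) (snd z))"
    proof
      assume "z \<in> ?U" then show ?thesis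
        by (intro exI[of _ ?U]) (use U cU in \<open>auto simp: subtopology_subtopology Int_absorb1\<close>)
    next
      assume "z \<in> ?V" then show ?thesis
        by (intro exI[of _ ?V]) (use V cV in \<open>auto simp: subtopology_subtopology Int_absorb1\<close>)
    qed
  qed
  then show ?thesis by simp
qed

section \<open>Extension of a flow over a collapse\<close>

lemma continuous_map_case_prod_compose:
  assumes "continuous_map (subtopology (prod_topology X Y) D) Z (\<lambda>(x, y). f x y)"
    and "continuous_map T X u" "continuous_map T Y v"
    and "\<And>t. t \<in> topspace T \<Longrightarrow> (u t, v t) \<in> D"
  shows "continuous_map T Z (\<lambda>t. f (u t) (v t))"
proof -
  have "continuous_map T (subtopology (prod_topology X Y) D) (\<lambda>t. (u t, v t))"
    using assms(2-4) by (auto simp: continuous_map_in_subtopology intro: continuous_map_pairedI)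
  from continuous_map_compose[OF this assms(1)] show ?thesis by (simp add: o_def)
qed

lemma continuous_map_real2_compose:
  fixes f :: "real \<times> real \<Rightarrow> real"
  assumes "continuous_on D f" "continuous_map T euclideanreal u" "continuous_map T euclideanreal v"
    and "\<And>t. t \<in> topspace T \<Longrightarrow> (u t, v t) \<in> D"
  shows "continuous_map T euclideanreal (\<lambda>t. f (u t, v t))"
proof -
  have "continuous_map T (top_of_set D) (\<lambda>t. (u t, v t))"
    using continuous_map_pairedI[OF assms(2,3)] assms(4) by (auto simp: continuous_map_in_subtopology)
  moreover have "continuous_map (top_of_set D) euclideanreal f" using assms(1) by simp
  ultimately show ?thesis by (rule continuous_map_compose[unfolded o_def])
qed

text \<open>A partial action of the positive reals under which \<open>lam\<close> scales linearly.
  The condition \<open>c * lam m \<le> 1\<close> says exactly that the target level does not exceed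
  1; on the spine \<open>lam = 0\<close> the action is therefore total.\<close>

locale collapse =
  fixes M :: "'a topology" and lam :: "'a \<Rightarrow> real" and X :: "real \<Rightarrow> 'a \<Rightarrow> 'a"
  assumes continuous_lam: "continuous_map M euclideanreal lam"
    and lam_nonneg: "\<And>m. m \<in> topspace M \<Longrightarrow> 0 \<le> lam m"
    and lam_le_1: "\<And>m. m \<in> topspace M \<Longrightarrow> lam m \<le> 1"
    and continuous_X: "continuous_map (subtopology (prod_topology euclideanreal M)
          {(c, m). 0 < c \<and> c * lam m \<le> 1}) M (\<lambda>(c, m). X c m)"
    and lam_X: "\<And>c m. m \<in> topspace M \<Longrightarrow> 0 < c \<Longrightarrow> c * lam m \<le> 1 \<Longrightarrow> lam (X c m) = c * lam m"
    and X_1: "\<And>m. m \<in> topspace M \<Longrightarrow> X 1 m = m"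
    and X_X: "\<And>c d m. m \<in> topspace M \<Longrightarrow> 0 < c \<Longrightarrow> 0 < d \<Longrightarrow> d * lam m \<le> 1 \<Longrightarrow>
          c * d * lam m \<le> 1 \<Longrightarrow> X c (X d m) = X (c * d) m"
begin

abbreviation "rim \<equiv> {m \<in> topspace M. lam m = 1}"

lemma X_closed:
  assumes "m \<in> topspace M" "0 < c" "c * lam m \<le> 1"
  shows "X c m \<in> topspace M"
  using continuous_map_image_subset_topspace[OF continuous_X] assms by fastforce

lemma continuous_X_compose:
  assumes "continuous_map T euclideanreal u" "continuous_map T M v"
    and "\<And>t. t \<in> topspace T \<Longrightarrow> 0 < u t \<and> u t * lam (v t) \<le> 1"
  shows "continuous_map T M (\<lambda>t. X (u t) (v t))"
  by (rule continuous_map_case_prod_compose[OF continuous_X assms(1,2)]) (use assms(3) in auto)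

context
  fixes \<phi> :: "real \<Rightarrow> 'a \<Rightarrow> 'a"
  assumes flow: "flow_on (subtopology M rim) \<phi>"
begin

text \<open>\<open>X (1 / lam m) m\<close> is the foot on the rim of the collar line through m. The
  value on the spine is forced by continuity: it is the motion by
  \<open>drift_speed t 0\<close>.\<close>

definition ext_flow :: "real \<Rightarrow> 'a \<Rightarrow> 'a" where
  "ext_flow t m = (if lam m = 0 then X (exp (- t)) m
     else X (drift t (lam m)) (\<phi> (boundary_clock t (lam m)) (X (1 / lam m) m)))"

lemma flow_rim:
  assumes "m \<in> rim"
  shows "\<phi> t m \<in> rim"
proof -
  have "continuous_map (prod_topology euclideanreal (subtopology M rim)) (subtopology M rim) (\<lambda>(t, x). \<phi> t x)"
    using flow by (simp add: flow_on_def)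
  from continuous_map_image_subset_topspace[OF this] show ?thesis using assms by fastforce
qed

lemma flow_0: "m \<in> rim \<Longrightarrow> \<phi> 0 m = m"
  and flow_add: "m \<in> rim \<Longrightarrow> \<phi> (s + t) m = \<phi> s (\<phi> t m)"
  using flow by (auto simp: flow_on_def)

lemma continuous_flow_compose:
  assumes "continuous_map T euclideanreal u" "continuous_map T M v"
    and "\<And>t. t \<in> topspace T \<Longrightarrow> v t \<in> rim"
  shows "continuous_map T M (\<lambda>t. \<phi> (u t) (v t))"
proof -
  have "continuous_map (prod_topology euclideanreal (subtopology M rim)) M (\<lambda>(t, x). \<phi> t x)"
    using flow by (simp add: flow_on_def continuous_map_in_subtopology)
  then have "continuous_map (subtopology (prod_topology euclideanreal (subtopology M rim)) UNIV) M (\<lambda>(t, x). \<phi> t x)"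
    by simp
  then show ?thesis
    by (rule continuous_map_case_prod_compose) (use assms in \<open>auto simp: continuous_map_in_subtopology\<close>)
qed

lemma X_inverse_lam_rim:
  assumes "m \<in> topspace M" "lam m \<noteq> 0"
  shows "X (1 / lam m) m \<in> rim"
  using assms lam_nonneg[of m] X_closed[of m "1 / lam m"] lam_X[of m "1 / lam m"] by simp

lemma ext_flow_rim: "m \<in> rim \<Longrightarrow> ext_flow t m = \<phi> t m"
  using flow_rim[of m] by (simp add: ext_flow_def X_1)

lemma lam_ext_flow:
  assumes "m \<in> topspace M"
  shows "lam (ext_flow t m) = drift t (lam m)"
proof (cases "lam m = 0")
  case True
  then show ?thesis using assms by (simp add: ext_flow_def lam_X drift_def)
next
  case False
  then have "0 < lam m" "lam m \<le> 1" using assms lam_nonneg[of m] lam_le_1 by auto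
  then show ?thesis
    using assms flow_rim[OF X_inverse_lam_rim[OF assms False], of "boundary_clock t (lam m)"]
      drift_le_1[of "lam m" t] drift_pos[of "lam m" t] by (simp add: ext_flow_def lam_X)
qed

lemma ext_flow_0:
  assumes "m \<in> topspace M"
  shows "ext_flow 0 m = m"
proof (cases "lam m = 0")
  case False
  then show ?thesis
    using assms lam_nonneg[of m] lam_le_1[of m] flow_0[OF X_inverse_lam_rim[OF assms False]]
    by (simp add: ext_flow_def X_X X_1)
qed (use assms in \<open>simp add: ext_flow_def X_1\<close>)

lemma ext_flow_add:
  assumes "m \<in> topspace M"
  shows "ext_flow (s + t) m = ext_flow s (ext_flow t m)"
proof (cases "lam m = 0")
  case True
  then have "lam (ext_flow t m) = 0" by (simp add: lam_ext_flow assms drift_def)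
  then have "ext_flow s (ext_flow t m) = X (exp (- s)) (X (exp (- t)) m)"
    using True by (simp add: ext_flow_def)
  also have "\<dots> = X (exp (- s) * exp (- t)) m" using True assms by (intro X_X) auto
  finally show ?thesis using True by (simp add: ext_flow_def exp_add[symmetric] algebra_simps)
next
  case False
  define l where "l = lam m"
  define p where "p = X (1 / l) m"
  have l: "0 < l" "l \<le> 1" using False assms lam_nonneg[of m] lam_le_1 by (auto simp: l_def)
  then have F: "0 < drift t l" "drift t l \<le> 1" by (auto simp: drift_pos drift_le_1)
  have p: "p \<in> rim" using X_inverse_lam_rim[OF assms False] by (simp add: p_def l_def)
  let ?q = "\<phi> (boundary_clock t l) p"
  have q: "?q \<in> rim" by (rule flow_rim[OF p])
  have e: "ext_flow t m = X (drift t l) ?q" using False by (simp add: ext_flow_def l_def p_def)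
  have "lam (ext_flow t m) = drift t l" by (simp add: lam_ext_flow assms l_def)
  then have "ext_flow s (ext_flow t m) =
      X (drift s (drift t l)) (\<phi> (boundary_clock s (drift t l)) (X (1 / drift t l) (X (drift t l) ?q)))"
    using F by (simp add: ext_flow_def[of s "X (drift t l) ?q"] e)
  \<comment> \<open>Undoing the inward move returns to the rim: after time t the foot of the collar
    line is \<open>?q\<close>.\<close>
  also have "X (1 / drift t l) (X (drift t l) ?q) = ?q"
    using X_X[of ?q "1 / drift t l" "drift t l"] q F by (simp add: X_1)
  also have "\<phi> (boundary_clock s (drift t l)) ?q = \<phi> (boundary_clock (s + t) l) p"
    using p l by (simp add: boundary_clock_add flow_add)
  also have "drift s (drift t l) = drift (s + t) l" using l by (simp add: drift_add)
  finally show ?thesis using False by (simp add: ext_flow_def l_def p_def)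
qed

text \<open>The clock reads 0, so the two moves along the collar line compose and the unbounded
  factor \<open>1 / lam m\<close> cancels against \<open>drift\<close>. The result no longer
  mentions the foot, which is what gives continuity at the spine.\<close>

lemma ext_flow_near_spine:
  assumes "m \<in> topspace M" "lam m < 1/2" "drift t (lam m) < 1/2"
  shows "ext_flow t m = X (drift_speed t (lam m)) m"
proof (cases "lam m = 0")
  case False
  have l: "0 < lam m" "lam m \<le> 1" using False assms lam_nonneg[of m] by auto
  then have "boundary_clock t (lam m) = 0" using assms by (simp add: boundary_clock_eq_0)
  then have "ext_flow t m = X (drift t (lam m)) (X (1 / lam m) m)"
    using False flow_0[OF X_inverse_lam_rim[OF assms(1) False]] by (simp add: ext_flow_def)
  also have "\<dots> = X (drift t (lam m) * (1 / lam m)) m"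
    using l assms drift_pos[of "lam m" t] by (intro X_X) auto
  finally show ?thesis using False by (simp add: drift_def)
qed (simp add: ext_flow_def)

lemma continuous_ext_flow:
  "continuous_map (prod_topology euclideanreal M) M (\<lambda>(t, m). ext_flow t m)"
proof (rule continuous_map_open_cover)
  let ?R = "prod_topology euclideanreal M"
  let ?U = "{z \<in> topspace ?R. lam (snd z) \<in> {0<..}}"
  \<comment> \<open>On the spine \<open>drift\<close> is 0 for every t, so this open set contains
    the spine at all times; the rest is covered by \<open>?U\<close>.\<close>
  let ?V = "{z \<in> topspace ?R. lam (snd z) \<in> {..<1/2}} \<inter>
            {z \<in> topspace ?R. drift (fst z) (lam (snd z)) \<in> {..<1/2}}"
  have t: "continuous_map ?R euclideanreal fst" and m: "continuous_map ?R M snd"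
    by (auto intro: continuous_map_fst continuous_map_snd)
  have l: "continuous_map ?R euclideanreal (\<lambda>z. lam (snd z))"
    using continuous_map_compose[OF m continuous_lam] by (simp add: o_def)
  have sp: "continuous_map ?R euclideanreal (\<lambda>z. drift_speed (fst z) (lam (snd z)))"
    using continuous_map_real2_compose[OF continuous_on_drift_speed t l] lam_nonneg lam_le_1 by auto
  have dr: "continuous_map ?R euclideanreal (\<lambda>z. drift (fst z) (lam (snd z)))"
    using continuous_map_real2_compose[OF continuous_on_drift t l] lam_nonneg lam_le_1 by auto
  have U: "openin ?R ?U" by (rule openin_continuous_map_preimage[OF l]) simp
  have V: "openin ?R ?V"
    by (intro openin_Int openin_continuous_map_preimage[OF l] openin_continuous_map_preimage[OF dr]) simp_all
  have cU: "continuous_map (subtopology ?R ?U) M (\<lambda>(t, m). ext_flow t m)"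
  proof -
    let ?T = "subtopology ?R ?U"
    have t': "continuous_map ?T euclideanreal fst" and m': "continuous_map ?T M snd"
      and l': "continuous_map ?T euclideanreal (\<lambda>z. lam (snd z))"
      and dr': "continuous_map ?T euclideanreal (\<lambda>z. drift (fst z) (lam (snd z)))"
      using t m l dr by (auto intro: continuous_map_from_subtopology)
    have ck: "continuous_map ?T euclideanreal (\<lambda>z. boundary_clock (fst z) (lam (snd z)))"
      using continuous_map_real2_compose[OF continuous_on_boundary_clock t' l'] lam_le_1 by auto
    have inv: "continuous_map ?T euclideanreal (\<lambda>z. 1 / lam (snd z))"
      by (intro continuous_map_real_divide l') auto
    have p: "continuous_map ?T M (\<lambda>z. X (1 / lam (snd z)) (snd z))"
      by (rule continuous_X_compose[OF inv m']) auto
    have "continuous_map ?T M (\<lambda>z. X (drift (fst z) (lam (snd z)))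
        (\<phi> (boundary_clock (fst z) (lam (snd z))) (X (1 / lam (snd z)) (snd z))))"
    proof (rule continuous_X_compose[OF dr' continuous_flow_compose[OF ck p]])
      fix z assume "z \<in> topspace ?T"
      then have z: "snd z \<in> topspace M" "0 < lam (snd z)" by auto
      then show "X (1 / lam (snd z)) (snd z) \<in> rim" by (intro X_inverse_lam_rim) auto
      then have "lam (\<phi> (boundary_clock (fst z) (lam (snd z))) (X (1 / lam (snd z)) (snd z))) = 1"
        using flow_rim by blast
      then show "0 < drift (fst z) (lam (snd z)) \<and> drift (fst z) (lam (snd z)) *
          lam (\<phi> (boundary_clock (fst z) (lam (snd z))) (X (1 / lam (snd z)) (snd z))) \<le> 1"
        using z lam_le_1 by (simp add: drift_pos drift_le_1)
    qed
    then show ?thesis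
      by (rule continuous_map_eq) (auto simp: ext_flow_def)
  qed
  have cV: "continuous_map (subtopology ?R ?V) M (\<lambda>(t, m). ext_flow t m)"
  proof -
    let ?T = "subtopology ?R ?V"
    have m': "continuous_map ?T M snd"
      and sp': "continuous_map ?T euclideanreal (\<lambda>z. drift_speed (fst z) (lam (snd z)))"
      using m sp by (auto intro: continuous_map_from_subtopology)
    have "continuous_map ?T M (\<lambda>z. X (drift_speed (fst z) (lam (snd z))) (snd z))"
    proof (rule continuous_X_compose[OF sp' m'])
      fix z assume "z \<in> topspace ?T"
      then have z: "snd z \<in> topspace M" by auto
      then show "0 < drift_speed (fst z) (lam (snd z)) \<and>
          drift_speed (fst z) (lam (snd z)) * lam (snd z) \<le> 1"
        using drift_le_1[of "lam (snd z)" "fst z"]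
        by (auto simp: drift_speed_pos lam_nonneg lam_le_1 drift_def mult.commute)
    qed
    then show ?thesis
      by (rule continuous_map_eq) (auto simp: ext_flow_near_spine)
  qed
  fix z assume z: "z \<in> topspace ?R"
  have "z \<in> ?U \<or> z \<in> ?V"
    using z lam_nonneg[of "snd z"] by (cases "lam (snd z) = 0") (auto simp: drift_def)
  then show "\<exists>W. openin ?R W \<and> z \<in> W \<and> continuous_map (subtopology ?R W) M (\<lambda>(t, m). ext_flow t m)"
    using U V cU cV by blast
qed

lemma flow_on_ext_flow: "flow_on M ext_flow"
  unfolding flow_on_def using continuous_ext_flow ext_flow_0 ext_flow_add by blast

text \<open>The level moves by \<open>drift\<close>, which fixes no level strictly between 0 and 1.
  On the spine \<open>exp (- t)\<close> takes every positive value, so rest means being fixed by all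
  of \<open>X\<close>.\<close>

lemma equilibria_ext_flow:
  "equilibria M ext_flow - rim = {m \<in> topspace M. lam m = 0 \<and> (\<forall>c>0. X c m = m)}"
proof (intro equalityI subsetI)
  fix m assume "m \<in> equilibria M ext_flow - rim"
  then have m: "m \<in> topspace M" "lam m \<noteq> 1" "\<And>t. ext_flow t m = m" by (auto simp: equilibria_def)
  have "drift 1 (lam m) = lam m" using lam_ext_flow[OF m(1), of 1] m(3) by simp
  with m have 0: "lam m = 0"
    using drift_fixed[of "lam m" 1] lam_nonneg[of m] lam_le_1[of m] by fastforce
  \<comment> \<open>The time \<open>- ln c\<close> realises the factor c.\<close>
  moreover have "X c m = m" if "c > 0" for c
    using m(3)[of "- ln c"] 0 that by (simp add: ext_flow_def)
  ultimately show "m \<in> {m \<in> topspace M. lam m = 0 \<and> (\<forall>c>0. X c m = m)}" using m by simp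
qed (auto simp: equilibria_def ext_flow_def)

end

theorem extend_flow:
  assumes "flow_on (subtopology M rim) \<phi>"
  obtains \<Phi> where "flow_on M \<Phi>" "\<And>t x. x \<in> rim \<Longrightarrow> \<Phi> t x = \<phi> t x"
    "equilibria M \<Phi> - rim = {m \<in> topspace M. lam m = 0 \<and> (\<forall>c>0. X c m = m)}"
  using flow_on_ext_flow[OF assms] ext_flow_rim[OF assms] equilibria_ext_flow[OF assms] that by blast

end

lemma flow_on_image:
  assumes "flow_on X \<phi>"
  shows "\<phi> t ` topspace X = topspace X"
proof -
  have c: "\<phi> s x \<in> topspace X" if "x \<in> topspace X" for s x
  proof -
    have "continuous_map (prod_topology euclideanreal X) X (\<lambda>(t, x). \<phi> t x)"
      using assms by (simp add: flow_on_def)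
    from continuous_map_image_subset_topspace[OF this] show ?thesis using that by fastforce
  qed
  have "x = \<phi> t (\<phi> (- t) x)" if "x \<in> topspace X" for x
    using assms that unfolding flow_on_def by (metis add.right_inverse)
  then show ?thesis using c by blast
qed

section \<open>Handles attached to a ball\<close>

text \<open>The core parameter runs over [-1, 1] so that the saddle point is the origin and the sign
  of w tells the two attaching discs apart.\<close>

definition cylinder :: "((real^2) \<times> real) set" where
  "cylinder = {(y, w). norm y \<le> 1 \<and> \<bar>w\<bar> \<le> 1}"

lemma cylinder_iff [simp]: "(y, w) \<in> cylinder \<longleftrightarrow> norm y \<le> 1 \<and> \<bar>w\<bar> \<le> 1"
  by (simp add: cylinder_def)

lemma cylinder_eq: "cylinder = cball 0 1 \<times> {-1..1}"
  by (auto simp: cylinder_def)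

text \<open>The handlebody given by coordinates on its pieces, in which the radial and the saddle
  flow are formulas. \<open>attaching\<close> and \<open>meeting\<close> together pin the overlap of
  a handle with the ball to its two end discs, placed on the sphere.\<close>

locale attached_handles =
  fixes M :: "'a topology" and g :: nat
    and b :: "real^3 \<Rightarrow> 'a" and k :: "nat \<Rightarrow> (real^2) \<times> real \<Rightarrow> 'a"
  assumes Hausdorff: "Hausdorff_space M"
    and continuous_b: "continuous_map (top_of_set (cball 0 1)) M b"
    and inj_b: "inj_on b (cball 0 1)"
    and continuous_k: "\<And>i. i < g \<Longrightarrow> continuous_map (top_of_set cylinder) M (k i)"
    and inj_k: "\<And>i. i < g \<Longrightarrow> inj_on (k i) cylinder"
    and topspace_eq: "topspace M = b ` cball 0 1 \<union> (\<Union>i<g. k i ` cylinder)"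
    and k_eqD: "\<And>i j z z'. i < g \<Longrightarrow> j < g \<Longrightarrow> z \<in> cylinder \<Longrightarrow> z' \<in> cylinder \<Longrightarrow>
          k i z = k j z' \<Longrightarrow> i = j"
    and attaching: "\<And>i y e. i < g \<Longrightarrow> norm y \<le> 1 \<Longrightarrow> \<bar>e\<bar> = 1 \<Longrightarrow> k i (y, e) \<in> b ` sphere 0 1"
    and meeting: "\<And>i v y w. i < g \<Longrightarrow> norm v \<le> 1 \<Longrightarrow> (y, w) \<in> cylinder \<Longrightarrow>
          b v = k i (y, w) \<Longrightarrow> \<bar>w\<bar> = 1"
begin

definition handles :: "'a set" where
  "handles = (\<Union>i<g. k i ` cylinder)"

definition binv :: "'a \<Rightarrow> real^3" where
  "binv = inv_into (cball 0 1) b"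

text \<open>On \<open>handles\<close> the choice is unique, because different handles are
  disjoint.\<close>

definition hidx :: "'a \<Rightarrow> nat" where
  "hidx m = (SOME i. i < g \<and> m \<in> k i ` cylinder)"

definition hcoord :: "'a \<Rightarrow> (real^2) \<times> real" where
  "hcoord m = inv_into cylinder (k (hidx m)) m"

text \<open>Meaningful for \<open>\<bar>snd z\<bar> = 1\<close>, where it is the attaching map into
  the unit sphere in ball coordinates.\<close>

definition att :: "nat \<Rightarrow> (real^2) \<times> real \<Rightarrow> real^3" where
  "att i z = binv (k i z)"

text \<open>The saddle flow \<open>(y, w) \<mapsto> (c y, w / c)\<close> of a handle leaves it through the attaching discs
  and is continued by the radial flow of the ball. Letting the handle coordinates run over all
  of \<open>\<bar>w\<bar> > 1\<close> turns both into the same formula.\<close>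

definition K :: "nat \<Rightarrow> (real^2) \<times> real \<Rightarrow> 'a" where
  "K i z = (if \<bar>snd z\<bar> \<le> 1 then k i z
     else b ((1 / \<bar>snd z\<bar>) *\<^sub>R att i (\<bar>snd z\<bar> *\<^sub>R fst z, sgn (snd z))))"

text \<open>In the ball the radius is followed as long as it lasts. Its end p is reached with the
  factor \<open>1 / norm v\<close>, and the remaining factor \<open>c * norm v\<close> is spent on
  the saddle flow from p. When \<open>c * lam m \<le> 1\<close>, that branch is entered only if p
  lies on an attaching disc.\<close>

definition X :: "real \<Rightarrow> 'a \<Rightarrow> 'a" where
  "X c m = (if m \<in> handles then K (hidx m) (c *\<^sub>R fst (hcoord m), snd (hcoord m) / c)
     else let v = binv m; p = b (sgn v) in
       if c * norm v \<le> 1 then b (c *\<^sub>R v)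
       else K (hidx p) ((c * norm v) *\<^sub>R fst (hcoord p), snd (hcoord p) / (c * norm v)))"

text \<open>The sphere outside the attaching discs belongs to S, hence the value 1; on a disc it is
  the radial coordinate of the handle. In the ball \<open>lam\<close> is the cone over these
  values.\<close>

definition lamS :: "'a \<Rightarrow> real" where
  "lamS m = (if m \<in> handles then norm (fst (hcoord m)) else 1)"

definition lam :: "'a \<Rightarrow> real" where
  "lam m = (if m \<in> handles then norm (fst (hcoord m))
     else norm (binv m) * lamS (b (sgn (binv m))))"

text \<open>The handle together with the cones over its attaching discs, in the coordinates of
  \<open>K\<close>. The product of \<open>norm y\<close> and \<open>\<bar>w\<bar>\<close> is
  constant along the saddle flow; beyond \<open>\<bar>w\<bar> = 1\<close> it is the norm of the disc
  point under the radius, so it must not exceed 1.\<close>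

definition \<Omega> :: "((real^2) \<times> real) set" where
  "\<Omega> = {(y, w). norm y \<le> 1 \<and> norm y * \<bar>w\<bar> \<le> 1}"

section \<open>Coordinates on the pieces and the algebraic laws of the collapse\<close>

lemma binv_b [simp]: "norm v \<le> 1 \<Longrightarrow> binv (b v) = v"
  unfolding binv_def by (rule inv_into_f_f[OF inj_b]) simp

lemma b_eq_iff: "norm v \<le> 1 \<Longrightarrow> norm v' \<le> 1 \<Longrightarrow> b v = b v' \<longleftrightarrow> v = v'"
  by (metis binv_b)

lemma hidx_k [simp]:
  assumes "i < g" "z \<in> cylinder"
  shows "hidx (k i z) = i"
proof -
  have "\<exists>j. j < g \<and> k i z \<in> k j ` cylinder" using assms by blast
  then have "hidx (k i z) < g \<and> k i z \<in> k (hidx (k i z)) ` cylinder"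
    unfolding hidx_def by (rule someI_ex)
  then obtain z' where "hidx (k i z) < g" "z' \<in> cylinder" "k i z = k (hidx (k i z)) z'" by blast
  then show ?thesis using k_eqD[OF assms(1) _ assms(2)] by metis
qed

lemma hcoord_k [simp]: "i < g \<Longrightarrow> z \<in> cylinder \<Longrightarrow> hcoord (k i z) = z"
  by (simp only: hcoord_def hidx_k) (rule inv_into_f_f[OF inj_k])

lemma k_handles [simp]: "i < g \<Longrightarrow> z \<in> cylinder \<Longrightarrow> k i z \<in> handles"
  unfolding handles_def by blast

lemma handlesE:
  assumes "m \<in> handles"
  obtains i y w where "i < g" "norm y \<le> 1" "\<bar>w\<bar> \<le> 1" "m = k i (y, w)"
proof -
  obtain i z where *: "i < g" "z \<in> cylinder" "m = k i z" using assms by (auto simp: handles_def)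
  then show ?thesis using that[of i "fst z" "snd z"] cylinder_iff[of "fst z" "snd z"] by simp
qed

lemma b_att [simp]: "i < g \<Longrightarrow> norm y \<le> 1 \<Longrightarrow> \<bar>e\<bar> = 1 \<Longrightarrow> b (att i (y, e)) = k i (y, e)"
  using attaching[of i y e] by (auto simp: att_def)

lemma norm_att [simp]: "i < g \<Longrightarrow> norm y \<le> 1 \<Longrightarrow> \<bar>e\<bar> = 1 \<Longrightarrow> norm (att i (y, e)) = 1"
  using attaching[of i y e] by (auto simp: att_def)

lemma b_handlesE:
  assumes "norm v \<le> 1" "b v \<in> handles"
  obtains i y e where "i < g" "norm y \<le> 1" "\<bar>e\<bar> = 1" "v = att i (y, e)"
proof -
  obtain i y w where *: "i < g" "norm y \<le> 1" "\<bar>w\<bar> \<le> 1" "b v = k i (y, w)"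
    using assms(2) by (rule handlesE)
  then have "\<bar>w\<bar> = 1" using meeting[of i v y w] assms by simp
  with * assms have "v = att i (y, w)" by (metis att_def binv_b)
  with * \<open>\<bar>w\<bar> = 1\<close> show ?thesis using that by blast
qed

lemma b_notin_handles: "norm v < 1 \<Longrightarrow> b v \<notin> handles"
  using b_handlesE[of v] by (metis less_eq_real_def less_irrefl norm_att)

lemma att_eqD:
  assumes "i < g" "norm y \<le> 1" "\<bar>e\<bar> = 1" "norm y' \<le> 1" "\<bar>e'\<bar> = 1" "att i (y, e) = att i (y', e')"
  shows "y = y' \<and> e = e'"
proof -
  have "k i (y, e) = k i (y', e')" using assms b_att by metis
  then show ?thesis using inj_onD[OF inj_k[OF assms(1)], of "(y, e)" "(y', e')"] assms by auto
qed

lemma K_le: "\<bar>w\<bar> \<le> 1 \<Longrightarrow> K i (y, w) = k i (y, w)"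
  by (simp add: K_def)

text \<open>In the continued coordinates the level \<open>\<bar>w\<bar> = 1 / r\<close> is the
  sphere of radius r, and y has shrunk by the same factor r.\<close>

lemma K_att:
  assumes "i < g" "norm y \<le> 1" "\<bar>e\<bar> = 1" "0 < r" "r \<le> 1"
  shows "K i (r *\<^sub>R y, e / r) = b (r *\<^sub>R att i (y, e))"
proof (cases "r = 1")
  case False
  then have "1 < \<bar>e / r\<bar>" "sgn (e / r) = e" "1 / \<bar>e / r\<bar> = r" "\<bar>e / r\<bar> *\<^sub>R r *\<^sub>R y = y"
    using assms by (auto simp: abs_if sgn_if field_simps split: if_splits)
  then show ?thesis by (simp add: K_def)
qed (use assms in \<open>simp add: K_le\<close>)

lemma \<Omega>_cases:
  assumes "(y, w) \<in> \<Omega>"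
  obtains (inside) "\<bar>w\<bar> \<le> 1" "norm y \<le> 1"
  | (outside) r x e where "0 < r" "r < 1" "norm x \<le> 1" "\<bar>e\<bar> = 1" "y = r *\<^sub>R x" "w = e / r"
proof (cases "\<bar>w\<bar> \<le> 1")
  case False
  have "w = sgn w / (1 / \<bar>w\<bar>)" by (simp add: sgn_mult_abs)
  moreover have "norm (\<bar>w\<bar> *\<^sub>R y) \<le> 1" using assms by (simp add: \<Omega>_def mult.commute)
  moreover have "\<bar>sgn w\<bar> = 1" using False by (auto simp: abs_sgn_eq)
  moreover have "y = (1 / \<bar>w\<bar>) *\<^sub>R \<bar>w\<bar> *\<^sub>R y" "0 < 1 / \<bar>w\<bar>" "1 / \<bar>w\<bar> < 1" using False by auto
  ultimately show ?thesis using outside by blast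
qed (use assms inside in \<open>auto simp: \<Omega>_def\<close>)

lemma \<Omega>_scale:
  assumes "(y, w) \<in> \<Omega>" "0 < c" "c * norm y \<le> 1"
  shows "(c *\<^sub>R y, w / c) \<in> \<Omega>"
  using assms by (auto simp: \<Omega>_def)

lemma K_topspace:
  assumes "i < g" "z \<in> \<Omega>"
  shows "K i z \<in> topspace M"
proof -
  obtain y w where z: "z = (y, w)" by fastforce
  from assms(2)[unfolded z] show ?thesis
  proof (cases rule: \<Omega>_cases)
    case inside
    then have "k i (y, w) \<in> k i ` cylinder" by simp
    then show ?thesis using inside assms(1) by (force simp: z K_le topspace_eq)
  next
    case (outside r x e)
    then have "r *\<^sub>R att i (x, e) \<in> cball 0 1" using assms(1) by simp
    then show ?thesis using outside assms(1) by (simp add: z K_att topspace_eq del: mem_cball)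
  qed
qed

text \<open>Points of an attaching disc belong to both branches of \<open>X\<close>. There
  \<open>norm v = 1\<close>, so c is at most 1 and the handle branch leaves along the radius, in
  agreement with the ball branch.\<close>

lemma X_b:
  assumes "norm v \<le> 1" "0 < c" "c * norm v \<le> 1"
  shows "X c (b v) = b (c *\<^sub>R v)"
proof (cases "b v \<in> handles")
  case True
  then obtain i y e where *: "i < g" "norm y \<le> 1" "\<bar>e\<bar> = 1" "v = att i (y, e)"
    using b_handlesE assms(1) by blast
  then show ?thesis using K_att[of i y e c] assms by (simp add: X_def)
qed (use assms in \<open>simp add: X_def\<close>)

lemma sgn_scale_unit: "norm a = 1 \<Longrightarrow> 0 < r \<Longrightarrow> sgn (r *\<^sub>R a) = (a :: 'v::real_normed_vector)"
  by (simp add: sgn_div_norm)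

text \<open>The purpose of \<open>K\<close>: passing between ball and handle needs no case
  distinction any more. For a starting point in the ball both branches of \<open>X\<close> give the
  same saddle formula, by \<open>K_att\<close>.\<close>

lemma X_K:
  assumes "i < g" "(y, w) \<in> \<Omega>" "0 < c" "c * norm y \<le> 1"
  shows "X c (K i (y, w)) = K i (c *\<^sub>R y, w / c)"
  using assms(2)
proof (cases rule: \<Omega>_cases)
  case inside
  then show ?thesis using assms(1) by (simp add: K_le X_def)
next
  case (outside r x e)
  let ?a = "att i (x, e)"
  have K: "K i (y, w) = b (r *\<^sub>R ?a)" using outside assms(1) by (simp add: K_att)
  have "b (r *\<^sub>R ?a) \<notin> handles" using outside assms(1) by (intro b_notin_handles) simp
  moreover have "sgn (r *\<^sub>R ?a) = ?a" using outside assms(1) by (intro sgn_scale_unit) auto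
  ultimately have "X c (b (r *\<^sub>R ?a)) =
     (if c * r \<le> 1 then b ((c * r) *\<^sub>R ?a) else K i ((c * r) *\<^sub>R x, e / (c * r)))"
    using outside assms(1) by (simp add: X_def)
  also have "\<dots> = K i ((c * r) *\<^sub>R x, e / (c * r))"
    using outside assms K_att[of i x e "c * r"] by simp
  finally show ?thesis unfolding K using outside by (simp add: mult.commute)
qed

lemma lam_b:
  assumes "norm v \<le> 1"
  shows "lam (b v) = norm v * lamS (b (sgn v))"
proof (cases "b v \<in> handles")
  case True
  then have "norm v = 1" using b_handlesE[OF assms] norm_att by metis
  then show ?thesis using True by (simp add: lam_def lamS_def sgn_div_norm)
qed (use assms in \<open>simp add: lam_def\<close>)

lemma lam_k: "i < g \<Longrightarrow> (y, w) \<in> cylinder \<Longrightarrow> lam (k i (y, w)) = norm y"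
  by (simp add: lam_def)

lemma lam_K:
  assumes "i < g" "(y, w) \<in> \<Omega>"
  shows "lam (K i (y, w)) = norm y"
  using assms(2)
proof (cases rule: \<Omega>_cases)
  case inside
  then show ?thesis using assms(1) by (simp add: K_le lam_k)
next
  case (outside r x e)
  let ?a = "att i (x, e)"
  have "sgn (r *\<^sub>R ?a) = ?a" using outside assms(1) by (intro sgn_scale_unit) auto
  then show ?thesis using outside assms(1) by (simp add: K_att lam_b lamS_def)
qed

text \<open>Normal forms for the collar lines: those that run through a handle, and the radii that
  end outside all attaching discs. The laws of \<open>X\<close> and \<open>lam\<close> are checked
  on each form separately.\<close>

lemma topspace_cases:
  assumes "m \<in> topspace M"
  obtains (saddle) i y w where "i < g" "(y, w) \<in> \<Omega>" "m = K i (y, w)"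
  | (radial) v where "norm v \<le> 1" "m = b v" "lam m = norm v"
proof (cases "m \<in> handles")
  case True
  then obtain i y w where *: "i < g" "norm y \<le> 1" "\<bar>w\<bar> \<le> 1" "m = k i (y, w)" by (rule handlesE)
  then have "(y, w) \<in> \<Omega>" by (auto simp: \<Omega>_def mult_le_one)
  then show ?thesis using * saddle[of i y w] by (simp add: K_le)
next
  case False
  then obtain v where v: "norm v \<le> 1" "m = b v" using assms by (auto simp: topspace_eq handles_def)
  show ?thesis
  proof (cases "b (sgn v) \<in> handles")
    case True
    then have "v \<noteq> 0" using b_notin_handles[of 0] by auto
    obtain i y e where *: "i < g" "norm y \<le> 1" "\<bar>e\<bar> = 1" "sgn v = att i (y, e)"
      using b_handlesE[OF _ True] by (metis norm_sgn order_refl zero_le_one)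
    have "norm v *\<^sub>R sgn v = v" using \<open>v \<noteq> 0\<close> by (simp add: sgn_div_norm)
    then have "v = norm v *\<^sub>R att i (y, e)" using *(4) by simp
    then have "m = K i (norm v *\<^sub>R y, e / norm v)"
      using * v \<open>v \<noteq> 0\<close> K_att[of i y e "norm v"] by simp
    moreover have "(norm v *\<^sub>R y, e / norm v) \<in> \<Omega>"
      using * v \<open>v \<noteq> 0\<close> by (auto simp: \<Omega>_def mult_le_one)
    ultimately show ?thesis using saddle *(1) by blast
  next
    case False
    \<comment> \<open>The centre of the ball falls under this case: \<open>sgn 0 = 0\<close>, and
      \<open>b 0\<close> lies in no handle.\<close>
    then show ?thesis using v radial by (simp add: lam_b lamS_def)
  qed
qed

lemma K_outside_notin_handles:
  assumes "i < g" "0 < r" "r < 1" "norm x \<le> 1" "\<bar>e\<bar> = 1"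
  shows "K i (r *\<^sub>R x, e / r) \<notin> handles"
  using assms by (auto simp: K_att intro!: b_notin_handles)

lemma K_eqD:
  assumes "i < g" "z \<in> \<Omega>" "z' \<in> \<Omega>" "K i z = K i z'"
  shows "z = z'"
proof -
  obtain y w y' w' where z: "z = (y, w)" "z' = (y', w')" by fastforce
  note out = K_outside_notin_handles[OF assms(1)]
  from assms(2)[unfolded z] show ?thesis
  proof (cases rule: \<Omega>_cases)
    case inside
    then have "K i z \<in> handles" using assms(1) z by (simp add: K_le)
    then have "K i (y', w') \<in> handles" using assms(4) z by simp
    from assms(3)[unfolded z] show ?thesis
    proof (cases rule: \<Omega>_cases)
      case 2: inside
      then have "k i z = k i z'" using inside assms(4) z by (simp add: K_le)
      then show ?thesis using inside 2 z inj_onD[OF inj_k[OF assms(1)], of z z'] by simp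
    next
      case (outside r x e)
      then show ?thesis using out \<open>K i (y', w') \<in> handles\<close> by metis
    qed
  next
    case (outside r x e)
    from assms(3)[unfolded z] show ?thesis
    proof (cases rule: \<Omega>_cases)
      case inside
      then have "K i (y', w') \<in> handles" using assms(1) by (simp add: K_le)
      then show ?thesis using outside out assms(4) z by metis
    next
      case 2: (outside r' x' e')
      have eq: "r *\<^sub>R att i (x, e) = r' *\<^sub>R att i (x', e')"
        using assms(1,4) outside 2 z by (simp add: K_att b_eq_iff)
      then have "norm (r *\<^sub>R att i (x, e)) = norm (r' *\<^sub>R att i (x', e'))" by simp
      then have "r = r'" using outside 2 assms(1) by simp
      then have "att i (x, e) = att i (x', e')" using eq outside by simp
      then show ?thesis using \<open>r = r'\<close> att_eqD[of i x e x' e'] outside 2 assms(1) z by simp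
    qed
  qed
qed

lemma lam_nonneg: "m \<in> topspace M \<Longrightarrow> 0 \<le> lam m"
  by (erule topspace_cases) (auto simp: lam_K)

lemma lam_le_1: "m \<in> topspace M \<Longrightarrow> lam m \<le> 1"
  by (erule topspace_cases) (auto simp: lam_K \<Omega>_def)

lemma lam_X:
  assumes "m \<in> topspace M" "0 < c" "c * lam m \<le> 1"
  shows "lam (X c m) = c * lam m"
  using assms(1)
proof (cases rule: topspace_cases)
  case (saddle i y w)
  then show ?thesis using assms \<Omega>_scale[of y w c] by (simp add: X_K lam_K)
next
  case (radial v)
  then have "X c m = b (c *\<^sub>R v)" using assms by (simp add: X_b)
  moreover have "sgn (c *\<^sub>R v) = sgn v" using assms by (simp add: sgn_scaleR)
  moreover have "norm (c *\<^sub>R v) \<le> 1" using radial assms by simp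
  ultimately show ?thesis using radial(1,2) assms lam_b[of "c *\<^sub>R v"] lam_b[of v] by simp
qed

lemma X_1: "m \<in> topspace M \<Longrightarrow> X 1 m = m"
  by (erule topspace_cases) (auto simp: X_K X_b \<Omega>_def)

lemma X_X:
  assumes "m \<in> topspace M" "0 < c" "0 < d" "d * lam m \<le> 1" "c * d * lam m \<le> 1"
  shows "X c (X d m) = X (c * d) m"
  using assms(1)
proof (cases rule: topspace_cases)
  case (saddle i y w)
  then show ?thesis using assms \<Omega>_scale[of y w d]
    by (simp add: X_K lam_K mult.assoc) (simp add: mult.commute)
next
  case (radial v)
  then show ?thesis using assms by (simp add: X_b mult.assoc)
qed

lemma fixed_iff:
  assumes "m \<in> topspace M"
  shows "lam m = 0 \<and> (\<forall>c>0. X c m = m) \<longleftrightarrow> m = b 0 \<or> (\<exists>i<g. m = k i (0, 0))"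
proof
  assume *: "lam m = 0 \<and> (\<forall>c>0. X c m = m)"
  from assms show "m = b 0 \<or> (\<exists>i<g. m = k i (0, 0))"
  proof (cases rule: topspace_cases)
    case (saddle i y w)
    then have "y = 0" using * by (simp add: lam_K)
    \<comment> \<open>The factor 2 already moves every point of the core and its radii except w = 0,
      since \<open>K\<close> is injective.\<close>
    then have "K i (0, w / 2) = K i (0, w)"
      using * saddle X_K[of i y w 2] by simp
    then have "(0 :: real^2, w / 2) = (0, w)"
      using saddle K_eqD[of i "(0, w / 2)" "(0, w)"] by (simp add: \<Omega>_def)
    then have "w = 0" by simp
    then show ?thesis using saddle \<open>y = 0\<close> by (auto simp: K_le)
  qed (use * in auto)
next
  assume "m = b 0 \<or> (\<exists>i<g. m = k i (0, 0))"
  then show "lam m = 0 \<and> (\<forall>c>0. X c m = m)"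
  proof
    assume "\<exists>i<g. m = k i (0, 0)"
    then obtain i where i: "i < g" "m = K i (0, 0)" by (auto simp: K_le)
    then show ?thesis using X_K[of i 0 0] lam_K[of i 0 0] by (simp add: \<Omega>_def)
  qed (auto simp: lam_b X_b)
qed

end

section \<open>Continuity in coordinates, the glued topology and the attaching discs\<close>

lemma compact_cylinder: "compact cylinder"
  by (simp add: cylinder_eq compact_Times)

lemma continuous_map_piece:
  assumes "compact S" "Hausdorff_space M" "continuous_map (top_of_set S) M q" "inj_on q S"
    and "continuous_map (top_of_set S) Y (\<lambda>z. f (q z))"
  shows "continuous_map (subtopology M (q ` S)) Y f"
proof -
  have "continuous_map (subtopology M (q ` S)) Y ((\<lambda>z. f (q z)) \<circ> inv_into S q)"
    by (rule continuous_map_compose[OF continuous_map_inv_into[OF assms(1-4)] assms(5)])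
  then show ?thesis by (rule continuous_map_eq) (auto simp: f_inv_into_f)
qed

context attached_handles begin

lemma continuous_b_compose:
  "continuous_on D h \<Longrightarrow> (\<And>z. z \<in> D \<Longrightarrow> norm (h z) \<le> 1) \<Longrightarrow> continuous_map (top_of_set D) M (\<lambda>z. b (h z))"
  by (rule continuous_map_compose_top_of_set[OF continuous_b]) auto

lemma continuous_k_compose:
  "i < g \<Longrightarrow> continuous_on D h \<Longrightarrow> h ` D \<subseteq> cylinder \<Longrightarrow> continuous_map (top_of_set D) M (\<lambda>z. k i (h z))"
  by (rule continuous_map_compose_top_of_set[OF continuous_k])

lemma continuous_binv_compose:
  assumes "continuous_map (top_of_set D) M h" "\<And>z. z \<in> D \<Longrightarrow> h z \<in> b ` cball 0 1"
  shows "continuous_on D (\<lambda>z. binv (h z))"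
  unfolding binv_def
  by (rule continuous_on_inv_into_compose[OF compact_cball Hausdorff continuous_b inj_b assms])

lemma continuous_hcoord_compose:
  assumes "i < g" "continuous_map (top_of_set D) M h" "\<And>z. z \<in> D \<Longrightarrow> h z \<in> k i ` cylinder"
  shows "continuous_on D (\<lambda>z. hcoord (h z))"
proof -
  have "continuous_on D (\<lambda>z. inv_into cylinder (k i) (h z))"
    by (rule continuous_on_inv_into_compose[OF compact_cylinder Hausdorff continuous_k[OF assms(1)]
          inj_k[OF assms(1)] assms(2,3)])
  moreover have "inv_into cylinder (k i) (h z) = hcoord (h z)" if z: "z \<in> D" for z
  proof -
    obtain p where "p \<in> cylinder" "h z = k i p" using assms(3)[OF z] by blast
    then show ?thesis using assms(1) by (simp add: inj_k)
  qed
  ultimately show ?thesis using continuous_on_cong by force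
qed

lemma continuous_att:
  assumes "i < g"
  shows "continuous_on (cball 0 1 \<times> {-1, 1}) (att i)"
  unfolding att_def
proof (rule continuous_binv_compose)
  show "continuous_map (top_of_set (cball 0 1 \<times> {-1, 1})) M (k i)"
    by (rule continuous_k_compose[OF assms continuous_on_id]) auto
  show "k i z \<in> b ` cball 0 1" if "z \<in> cball 0 1 \<times> {-1, 1}" for z
    using that attaching[OF assms, of "fst z" "snd z"] by (cases z) auto
qed

lemma continuous_att_compose:
  assumes "i < g" "continuous_on D h" "\<And>z. z \<in> D \<Longrightarrow> norm (fst (h z)) \<le> 1 \<and> \<bar>snd (h z)\<bar> = 1"
  shows "continuous_on D (\<lambda>z. att i (h z))"
proof (rule continuous_on_compose2[OF continuous_att[OF assms(1)] assms(2)])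
  show "h ` D \<subseteq> cball 0 1 \<times> {-1, 1}"
  proof (rule image_subsetI)
    fix z assume "z \<in> D"
    then have "norm (fst (h z)) \<le> 1" "\<bar>snd (h z)\<bar> = 1" using assms(3) by auto
    then show "h z \<in> cball 0 1 \<times> {-1, 1}" by (cases "h z") (auto simp: abs_if split: if_splits)
  qed
qed

lemma closedin_b_cball: "closedin M (b ` cball 0 1)"
  by (rule closedin_compact_image[OF compact_cball Hausdorff continuous_b]) simp

lemma closedin_k_cylinder: "i < g \<Longrightarrow> closedin M (k i ` cylinder)"
  by (rule closedin_compact_image[OF compact_cylinder Hausdorff continuous_k]) simp_all

lemma closedin_handles: "closedin M handles"
  unfolding handles_def by (rule closedin_Union) (auto intro: closedin_k_cylinder)

lemma b_topspace: "norm v \<le> 1 \<Longrightarrow> b v \<in> topspace M"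
  by (auto simp: topspace_eq)

lemma k_topspace: "i < g \<Longrightarrow> z \<in> cylinder \<Longrightarrow> k i z \<in> topspace M"
  by (auto simp: topspace_eq)

lemma continuous_glue:
  assumes "continuous_map (top_of_set (cball 0 1)) Y (\<lambda>v. f (b v))"
    and "\<And>i. i < g \<Longrightarrow> continuous_map (top_of_set cylinder) Y (\<lambda>z. f (k i z))"
  shows "continuous_map M Y f"
proof (rule continuous_map_closed_cover)
  let ?C = "insert (b ` cball 0 1) ((\<lambda>i. k i ` cylinder) ` {..<g})"
  show "finite ?C" "topspace M \<subseteq> \<Union> ?C" by (auto simp: topspace_eq)
  fix C assume "C \<in> ?C"
  then show "closedin M C \<and> continuous_map (subtopology M C) Y f"
    using continuous_map_piece[OF compact_cball Hausdorff continuous_b inj_b assms(1)]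
      continuous_map_piece[OF compact_cylinder Hausdorff continuous_k inj_k assms(2)] closedin_b_cball closedin_k_cylinder
    by auto
qed

text \<open>The pieces are finitely many compact sets in a Hausdorff space, so the complement of U
  is a finite union of closed images.\<close>

lemma openin_glue:
  assumes "U \<subseteq> topspace M" "openin (top_of_set (cball 0 1)) {v \<in> cball 0 1. b v \<in> U}"
    and "\<And>i. i < g \<Longrightarrow> openin (top_of_set cylinder) {z \<in> cylinder. k i z \<in> U}"
  shows "openin M U"
proof -
  let ?V = "cball 0 1 - {v \<in> cball 0 1. b v \<in> U}"
  let ?W = "\<lambda>i. cylinder - {z \<in> cylinder. k i z \<in> U}"
  have "closedin M (b ` ?V)"
    by (rule closedin_compact_image[OF compact_cball Hausdorff continuous_b])
      (use assms(2) in \<open>intro closedin_diff, auto\<close>)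
  moreover have "closedin M (\<Union>i<g. k i ` ?W i)"
  proof (rule closedin_Union)
    fix T assume "T \<in> (\<lambda>i. k i ` ?W i) ` {..<g}"
    then obtain i where i: "i < g" "T = k i ` ?W i" by blast
    have "closedin (top_of_set cylinder) (?W i)" using assms(3)[OF i(1)] by (intro closedin_diff) auto
    then show "closedin M T" unfolding i(2)
      by (rule closedin_compact_image[OF compact_cylinder Hausdorff continuous_k[OF i(1)]])
  qed simp
  ultimately have "closedin M (b ` ?V \<union> (\<Union>i<g. k i ` ?W i))" by (rule closedin_Un)
  moreover have "b ` ?V \<union> (\<Union>i<g. k i ` ?W i) = topspace M - U"
    unfolding topspace_eq by auto
  ultimately show ?thesis using assms(1) by (simp add: openin_closedin_eq)
qed

lemma continuous_K:
  assumes "i < g"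
  shows "continuous_map (top_of_set \<Omega>) M (K i)"
proof (rule continuous_map_top_of_set_halves[where p = "\<lambda>z. \<bar>snd z\<bar>" and a = 1])
  show "continuous_on \<Omega> (\<lambda>z. \<bar>snd z\<bar>)" by (intro continuous_intros)
  have "continuous_map (top_of_set {z \<in> \<Omega>. \<bar>snd z\<bar> \<le> 1}) M (\<lambda>z. k i z)"
    by (rule continuous_k_compose[OF assms continuous_on_id]) (auto simp: \<Omega>_def)
  then show "continuous_map (top_of_set {z \<in> \<Omega>. \<bar>snd z\<bar> \<le> 1}) M (K i)"
    by (rule continuous_map_eq) (auto simp: K_le)
  let ?D = "{z \<in> \<Omega>. 1 \<le> \<bar>snd z\<bar>}"
  have D: "norm (\<bar>snd z\<bar> *\<^sub>R fst z) \<le> 1 \<and> \<bar>sgn (snd z)\<bar> = 1" if "z \<in> ?D" for z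
    using that by (auto simp: \<Omega>_def mult.commute abs_sgn_eq)
  have "continuous_on ?D (\<lambda>z. att i (\<bar>snd z\<bar> *\<^sub>R fst z, sgn (snd z)))"
    by (rule continuous_att_compose[OF assms]) (use D in \<open>auto intro!: continuous_intros\<close>)
  then have "continuous_on ?D (\<lambda>z. (1 / \<bar>snd z\<bar>) *\<^sub>R att i (\<bar>snd z\<bar> *\<^sub>R fst z, sgn (snd z)))"
    by (intro continuous_intros) auto
  then have "continuous_map (top_of_set ?D) M
      (\<lambda>z. b ((1 / \<bar>snd z\<bar>) *\<^sub>R att i (\<bar>snd z\<bar> *\<^sub>R fst z, sgn (snd z))))"
    by (rule continuous_b_compose) (use D assms in auto)
  then show "continuous_map (top_of_set ?D) M (K i)"
  proof (rule continuous_map_eq)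
    fix z assume "z \<in> topspace (top_of_set ?D)"
    then have z: "z \<in> ?D" by simp
    \<comment> \<open>On the common level \<open>\<bar>snd z\<bar> = 1\<close> the ball formula
      becomes \<open>b (att i z)\<close>, which is \<open>k i z\<close>.\<close>
    show "b ((1 / \<bar>snd z\<bar>) *\<^sub>R att i (\<bar>snd z\<bar> *\<^sub>R fst z, sgn (snd z))) = K i z"
    proof (cases "\<bar>snd z\<bar> = 1")
      case True
      then have "sgn (snd z) = snd z" by (auto simp: abs_if sgn_if split: if_splits)
      then show ?thesis using True z assms D[OF z] by (cases z) (simp add: K_def)
    qed (use z in \<open>auto simp: K_def\<close>)
  qed
qed

lemma continuous_K_compose:
  "i < g \<Longrightarrow> continuous_on D h \<Longrightarrow> (\<And>z. z \<in> D \<Longrightarrow> h z \<in> \<Omega>) \<Longrightarrow> continuous_map (top_of_set D) M (\<lambda>z. K i (h z))"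
  by (rule continuous_map_compose_top_of_set[OF continuous_K]) auto

text \<open>Invariance of domain in dimension three, applied to the cone over an attaching disc,
  shows that the attaching disc is relatively open in the sphere.\<close>

definition cone :: "nat \<Rightarrow> real \<Rightarrow> (real^2) \<times> real \<Rightarrow> real^3" where
  "cone i e = (\<lambda>(y, r). r *\<^sub>R att i (y, e))"

lemma open_cone_image:
  assumes "i < g" "\<bar>e\<bar> = 1" "open T" "T \<subseteq> ball 0 1 \<times> {0<..}"
  shows "open (cone i e ` T)"
proof (rule invariance_of_domain_gen)
  have T: "norm y < 1 \<and> 0 < r" if "(y, r) \<in> T" for y r using that assms(4) by auto
  have "continuous_on T (\<lambda>z. att i (fst z, e))"
    by (rule continuous_att_compose[OF assms(1)])
      (use assms(2) T in \<open>force intro!: continuous_intros\<close>)+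
  then show "continuous_on T (cone i e)"
    unfolding cone_def case_prod_unfold by (intro continuous_intros)
  show "inj_on (cone i e) T"
  proof (rule inj_onI, clarify)
    fix y r y' r' assume "(y, r) \<in> T" "(y', r') \<in> T" and eq: "cone i e (y, r) = cone i e (y', r')"
    then have *: "norm y \<le> 1" "0 < r" "norm y' \<le> 1" "0 < r'" using T by force+
    then have "norm (att i (y, e)) = 1" "norm (att i (y', e)) = 1" using assms by auto
    \<comment> \<open>\<open>att\<close> has norm 1 here, so comparing norms recovers r.\<close>
    moreover have eq': "r *\<^sub>R att i (y, e) = r' *\<^sub>R att i (y', e)" using eq by (simp add: cone_def)
    moreover from this have "\<bar>r\<bar> * norm (att i (y, e)) = \<bar>r'\<bar> * norm (att i (y', e))"
      by (metis norm_scaleR)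
    ultimately have "r = r'" using * by simp
    with eq' * have "att i (y, e) = att i (y', e)" by simp
    then show "y = y' \<and> r = r'" using att_eqD[of i y e y' e] * assms \<open>r = r'\<close> by simp
  qed
qed (use assms(3) in auto)

lemma lamS_le_1: "norm v = 1 \<Longrightarrow> lamS (b v) \<le> 1"
  by (auto simp: lamS_def elim!: b_handlesE[rotated])

text \<open>The complement in the sphere consists of the open attaching discs, cut out by the open
  cones over them. Together with the closed discs this set forms the finite closed cover on which
  continuity of \<open>lamS\<close> is checked.\<close>

lemma closed_rim_sphere: "closed {a \<in> sphere 0 1. lamS (b a) = 1}"
proof -
  let ?P = "\<lambda>i e. cone i e ` (ball 0 1 \<times> {0<..})"
  have "open (\<Union>i<g. \<Union>e\<in>{-1, 1}. ?P i e)"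
    by (intro open_UN ballI open_cone_image) (auto intro: open_Times)
  moreover have "{a \<in> sphere 0 1. lamS (b a) = 1} = sphere 0 1 - (\<Union>i<g. \<Union>e\<in>{-1, 1}. ?P i e)"
  proof (intro equalityI subsetI)
    fix a assume "a \<in> {a \<in> sphere 0 1. lamS (b a) = 1}"
    then have a: "norm a = 1" "lamS (b a) = 1" by auto
    have "a \<notin> ?P i e" if i: "i < g" and e: "e \<in> {-1, 1}" for i e
    proof
      assume "a \<in> ?P i e"
      then obtain y r where *: "norm y < 1" "0 < r" "a = r *\<^sub>R att i (y, e)" by (auto simp: cone_def)
      have "\<bar>e\<bar> = 1" using e by auto
      then have "r = 1" using a * i by simp
      then have "lamS (b a) = norm y" using * i \<open>\<bar>e\<bar> = 1\<close> by (simp add: lamS_def)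
      then show False using a * by simp
    qed
    then show "a \<in> sphere 0 1 - (\<Union>i<g. \<Union>e\<in>{-1, 1}. ?P i e)" using a by auto
  next
    fix a assume a: "a \<in> sphere 0 1 - (\<Union>i<g. \<Union>e\<in>{-1, 1}. ?P i e)"
    have "lamS (b a) = 1"
    proof (cases "b a \<in> handles")
      case True
      then obtain i y e where *: "i < g" "norm y \<le> 1" "\<bar>e\<bar> = 1" "a = att i (y, e)"
        using b_handlesE[of a] a by auto
      have "\<not> norm y < 1"
      proof
        assume "norm y < 1"
        then have "cone i e (y, 1) \<in> ?P i e" by (intro imageI) simp
        moreover have "e \<in> {-1, 1}" using * by auto
        moreover have "cone i e (y, 1) = a" using * by (simp add: cone_def)
        ultimately show False using a *(1) by blast
      qed
      then show ?thesis using * by (simp add: lamS_def)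
    qed (simp add: lamS_def)
    then show "a \<in> {a \<in> sphere 0 1. lamS (b a) = 1}" using a by simp
  qed
  ultimately show ?thesis by (simp add: closed_Diff)
qed

text \<open>Both attaching discs of one handle at once.\<close>

definition disc :: "nat \<Rightarrow> (real^3) set" where
  "disc i = {a \<in> sphere 0 1. b a \<in> k i ` cylinder}"

lemma disc_iff:
  assumes "i < g"
  shows "a \<in> disc i \<longleftrightarrow> (\<exists>y e. norm y \<le> 1 \<and> \<bar>e\<bar> = 1 \<and> a = att i (y, e))"
proof
  assume "a \<in> disc i"
  then obtain y w where *: "norm a = 1" "norm y \<le> 1" "\<bar>w\<bar> \<le> 1" "b a = k i (y, w)"
    by (auto simp: disc_def cylinder_def)
  then have "\<bar>w\<bar> = 1" using meeting[of i a y w] assms by simp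
  moreover have "a = att i (y, w)" using * by (metis att_def binv_b order_refl)
  ultimately show "\<exists>y e. norm y \<le> 1 \<and> \<bar>e\<bar> = 1 \<and> a = att i (y, e)" using * by blast
next
  assume "\<exists>y e. norm y \<le> 1 \<and> \<bar>e\<bar> = 1 \<and> a = att i (y, e)"
  then show "a \<in> disc i" using assms by (auto simp: disc_def intro!: imageI)
qed

lemma compact_disc:
  assumes "i < g"
  shows "compact (disc i)"
proof -
  have "closedin (top_of_set (sphere 0 1)) {a \<in> topspace (top_of_set (sphere 0 1)). b a \<in> k i ` cylinder}"
    by (rule closedin_continuous_map_preimage[OF continuous_b_compose[OF continuous_on_id]
          closedin_k_cylinder[OF assms]]) simp
  then have "closed (disc i)" by (simp add: disc_def closedin_closed_eq)
  moreover have "bounded (disc i)" by (rule bounded_subset[OF bounded_sphere[of 0 1]]) (auto simp: disc_def)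
  ultimately show ?thesis by (simp add: compact_eq_bounded_closed)
qed

lemma continuous_hcoord_disc:
  assumes "i < g"
  shows "continuous_on (disc i) (\<lambda>a. hcoord (b a))"
  by (rule continuous_hcoord_compose[OF assms continuous_b_compose[OF continuous_on_id]])
    (auto simp: disc_def)

lemma continuous_lamS: "continuous_on (sphere 0 1) (\<lambda>a. lamS (b a))"
proof -
  have "continuous_map (top_of_set (sphere 0 1)) euclideanreal (\<lambda>a. lamS (b a))"
  proof (rule continuous_map_closed_cover)
    let ?R = "{a \<in> sphere 0 1. lamS (b a) = 1}"
    let ?C = "insert ?R (disc ` {..<g})"
    show "finite ?C" by simp
    show "topspace (top_of_set (sphere 0 1)) \<subseteq> \<Union> ?C"
      by (auto simp: lamS_def disc_def handles_def)
    fix C assume "C \<in> ?C"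
    then consider "C = ?R" | i where "i < g" "C = disc i" by blast
    then show "closedin (top_of_set (sphere 0 1)) C \<and>
        continuous_map (subtopology (top_of_set (sphere 0 1)) C) euclideanreal (\<lambda>a. lamS (b a))"
    proof cases
      case 1
      have "continuous_on ?R (\<lambda>a. lamS (b a))"
        by (subst continuous_on_cong[OF refl, where g = "\<lambda>_. 1"]) auto
      moreover have "sphere 0 1 \<inter> C = ?R" using 1 by auto
      ultimately show ?thesis using 1 closed_rim_sphere
        by (auto simp: subtopology_subtopology closedin_closed_eq)
    next
      case 2
      have "continuous_on (disc i) (\<lambda>a. norm (fst (hcoord (b a))))"
        by (intro continuous_intros continuous_hcoord_disc 2)
      then have "continuous_on (disc i) (\<lambda>a. lamS (b a))"
        by (rule continuous_on_eq) (use 2 in \<open>auto simp: lamS_def disc_def handles_def\<close>)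
      moreover have "sphere 0 1 \<inter> C = disc i" using 2 by (auto simp: disc_def)
      moreover have "closed C" using compact_disc 2 compact_imp_closed by blast
      ultimately show ?thesis using 2 
        by (auto simp: subtopology_subtopology closedin_closed_eq disc_def)
    qed
  qed
  then show ?thesis by simp
qed

end

section \<open>Continuity of the collapse\<close>

text \<open>At the origin \<open>sgn\<close> jumps, but the bound on \<open>\<mu>\<close> lets the
  factor \<open>norm v\<close> force the limit 0.\<close>

lemma continuous_on_cone_extension:
  fixes \<mu> :: "'b::real_normed_vector \<Rightarrow> real"
  assumes "continuous_on (sphere 0 1) \<mu>" "\<And>a. norm a = 1 \<Longrightarrow> \<bar>\<mu> a\<bar> \<le> C"
  shows "continuous_on UNIV (\<lambda>v. norm v * \<mu> (sgn v))"
proof -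
  have "isCont (\<lambda>v. norm v * \<mu> (sgn v)) v" for v
  proof (cases "v = 0")
    case True
    have "((\<lambda>v. norm v * \<mu> (sgn v)) \<longlongrightarrow> 0) (at 0)"
    proof (rule Lim_null_comparison)
      show "\<forall>\<^sub>F v in at 0. norm (norm v * \<mu> (sgn v)) \<le> norm v * C"
        unfolding eventually_at_filter
        by (rule always_eventually) (auto simp: abs_mult norm_sgn intro!: mult_left_mono assms(2))
      show "((\<lambda>v. norm v * C) \<longlongrightarrow> 0) (at 0)" by (rule tendsto_eq_intros | simp)+
    qed
    then show ?thesis using True by (simp add: isCont_def)
  next
    case False
    have "continuous_on (- {0}) (\<lambda>v. norm v * \<mu> (sgn v))"
      by (intro continuous_intros continuous_on_compose2[OF assms(1)] continuous_on_sgn)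
        (auto simp: norm_sgn split: if_splits)
    then show ?thesis using False
      by (simp add: continuous_on_eq_continuous_at open_Compl)
  qed
  then show ?thesis by (simp add: continuous_at_imp_continuous_on)
qed

context attached_handles begin

lemma continuous_lam: "continuous_map M euclideanreal lam"
proof (rule continuous_glue)
  have "\<bar>lamS (b a)\<bar> \<le> 1" if "norm a = 1" for a
    using lamS_le_1[OF that] by (auto simp: lamS_def)
  then have "continuous_on UNIV (\<lambda>v. norm v * lamS (b (sgn v)))"
    by (rule continuous_on_cone_extension[OF continuous_lamS])
  then have "continuous_on (cball 0 1) (\<lambda>v. norm v * lamS (b (sgn v)))"
    by (rule continuous_on_subset) simp
  then have "continuous_on (cball 0 1) (\<lambda>v. lam (b v))"
    by (rule continuous_on_eq) (simp add: lam_b)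
  then show "continuous_map (top_of_set (cball 0 1)) euclideanreal (\<lambda>v. lam (b v))" by simp
next
  fix i assume i: "i < g"
  have "continuous_on cylinder (\<lambda>z. norm (fst z))" by (intro continuous_intros)
  then have "continuous_on cylinder (\<lambda>z. lam (k i z))"
    by (rule continuous_on_eq) (auto simp: cylinder_def i lam_k)
  then show "continuous_map (top_of_set cylinder) euclideanreal (\<lambda>z. lam (k i z))" by simp
qed

definition disc_cone :: "nat \<Rightarrow> (real^3) set" where
  "disc_cone i = (\<lambda>(r, a). r *\<^sub>R a) ` ({0..1} \<times> disc i)"

lemma compact_disc_cone: "i < g \<Longrightarrow> compact (disc_cone i)"
  unfolding disc_cone_def case_prod_unfold
  by (intro compact_continuous_image compact_Times compact_disc compact_Icc continuous_intros)

text \<open>A point over a disc is \<open>K i (r y, e / r)\<close> with r its norm, so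
  \<open>X_K\<close> applies; y and e are read off from \<open>sgn v\<close>, which keeps the
  formula continuous in v.\<close>

lemma X_b_outside:
  assumes "i < g" "v \<in> disc_cone i" "norm v \<le> 1" "1 \<le> c * norm v" "0 < c" "c * lam (b v) \<le> 1"
  shows "sgn v \<in> disc i"
    and "((c * norm v) *\<^sub>R fst (hcoord (b (sgn v))), snd (hcoord (b (sgn v))) / (c * norm v)) \<in> \<Omega>"
    and "X c (b v) = K i ((c * norm v) *\<^sub>R fst (hcoord (b (sgn v))), snd (hcoord (b (sgn v))) / (c * norm v))"
proof -
  obtain r a where ra: "0 \<le> r" "a \<in> disc i" "v = r *\<^sub>R a" using assms(2) by (auto simp: disc_cone_def)
  obtain y e where ye: "norm y \<le> 1" "\<bar>e\<bar> = 1" "a = att i (y, e)"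
    using ra(2) disc_iff[OF assms(1)] by blast
  have na: "norm a = 1" using ye assms(1) by simp
  then have nv: "norm v = r" using ra by simp
  have "0 < r" using nv assms(4) ra(1) by (cases "r = 0") auto
  then have sgn: "sgn v = a" using ra na by (simp add: sgn_scale_unit)
  then show "sgn v \<in> disc i" using ra by simp
  have h: "hcoord (b (sgn v)) = (y, e)" using sgn ye assms(1) by simp
  have bv: "b v = K i (r *\<^sub>R y, e / r)"
    using K_att[of i y e r] assms(1,3) ye ra nv \<open>0 < r\<close> by simp
  have O: "(r *\<^sub>R y, e / r) \<in> \<Omega>" using ye \<open>0 < r\<close> assms(3) nv by (auto simp: \<Omega>_def mult_le_one)
  then have cl: "c * (r * norm y) \<le> 1"
    using assms(1,6) \<open>0 < r\<close> lam_K[OF assms(1) O] by (simp add: bv)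
  show "((c * norm v) *\<^sub>R fst (hcoord (b (sgn v))), snd (hcoord (b (sgn v))) / (c * norm v)) \<in> \<Omega>"
    using \<Omega>_scale[OF O, of c] cl assms(5) \<open>0 < r\<close> by (simp add: h nv mult.commute)
  show "X c (b v) = K i ((c * norm v) *\<^sub>R fst (hcoord (b (sgn v))), snd (hcoord (b (sgn v))) / (c * norm v))"
    using X_K[OF assms(1) O assms(5)] cl \<open>0 < r\<close> by (simp add: bv h nv mult.commute)
qed

text \<open>Away from the cones over the discs \<open>lam (b v)\<close> equals
  \<open>norm v\<close>, so the domain of \<open>X\<close> allows no factor that would leave the
  ball.\<close>

lemma radial_cases:
  assumes "norm v \<le> 1" "0 < c" "c * lam (b v) \<le> 1"
  shows "c * norm v \<le> 1 \<or> (1 \<le> c * norm v \<and> (\<exists>i<g. v \<in> disc_cone i))"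
proof (cases "b (sgn v) \<in> handles")
  case True
  then obtain i y e where *: "i < g" "norm y \<le> 1" "\<bar>e\<bar> = 1" "sgn v = att i (y, e)"
    using b_handlesE[OF _ True] by (metis norm_sgn order_refl zero_le_one)
  then have "sgn v \<in> disc i" using disc_iff by blast
  moreover have "v = norm v *\<^sub>R sgn v" by (cases "v = 0") (simp_all add: sgn_div_norm)
  ultimately have "v \<in> disc_cone i"
    using assms(1) unfolding disc_cone_def by (intro image_eqI[where x = "(norm v, sgn v)"]) auto
  then show ?thesis using *(1) by force
qed (use assms in \<open>simp add: lam_b lamS_def\<close>)

lemma continuous_X_ball:
  "continuous_map (top_of_set {(c, v). v \<in> cball 0 1 \<and> (c, b v) \<in> {(c, m). 0 < c \<and> c * lam m \<le> 1}})
     M (\<lambda>(c, v). X c (b v))"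
proof -
  define D where "D = {(c, v). v \<in> cball 0 1 \<and> (c, b v) \<in> {(c, m). 0 < c \<and> c * lam m \<le> 1}}"
  let ?p = "\<lambda>z :: real \<times> (real^3). fst z * norm (snd z)"
  let ?E = "{z \<in> D. 1 \<le> ?p z}"
  let ?G = "\<lambda>i. {z \<in> ?E. snd z \<in> disc_cone i}"
  have D: "norm (snd z) \<le> 1" "0 < fst z" "fst z * lam (b (snd z)) \<le> 1" if "z \<in> D" for z
    using that by (auto simp: D_def)
  have "continuous_map (top_of_set D) M (\<lambda>(c, v). X c (b v))"
  proof (rule continuous_map_top_of_set_halves[where p = ?p and a = 1])
    show "continuous_on D ?p" by (intro continuous_intros)
    have "continuous_map (top_of_set {z \<in> D. ?p z \<le> 1}) M (\<lambda>z. b (fst z *\<^sub>R snd z))"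
      by (rule continuous_b_compose) (use D(2) in \<open>force intro!: continuous_intros\<close>)+
    then show "continuous_map (top_of_set {z \<in> D. ?p z \<le> 1}) M (\<lambda>(c, v). X c (b v))"
      by (rule continuous_map_eq) (use D in \<open>force simp: X_b\<close>)
    show "continuous_map (top_of_set ?E) M (\<lambda>(c, v). X c (b v))"
    proof (rule continuous_map_closed_cover)
      \<comment> \<open>Each handle needs its own closed piece, because \<open>hcoord\<close> is
        known to be continuous on one handle at a time. The set where \<open>?p\<close> is 1
        collects the points outside all cones, by \<open>radial_cases\<close>.\<close>
      let ?C = "insert {z \<in> D. ?p z = 1} (?G ` {..<g})"
      show "finite ?C" by simp
      show "topspace (top_of_set ?E) \<subseteq> \<Union> ?C"
      proof
        fix z assume "z \<in> topspace (top_of_set ?E)"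
        then have z: "z \<in> ?E" by simp
        then show "z \<in> \<Union> ?C" using radial_cases[of "snd z" "fst z"] D[of z] by fastforce
      qed
      fix C assume "C \<in> ?C"
      then consider "C = {z \<in> D. ?p z = 1}" | i where "i < g" "C = ?G i" by blast
      then show "closedin (top_of_set ?E) C \<and>
          continuous_map (subtopology (top_of_set ?E) C) M (\<lambda>(c, v). X c (b v))"
      proof cases
        case 1
        have "continuous_map (top_of_set ?E) euclideanreal ?p"
          by (simp, intro continuous_intros)
        from closedin_continuous_map_preimage[OF this, of "{1}"]
        have "closedin (top_of_set ?E) {z \<in> ?E. ?p z = 1}" by simp
        moreover have "{z \<in> ?E. ?p z = 1} = C" using 1 by auto
        moreover have "continuous_map (top_of_set C) M (\<lambda>z. b (fst z *\<^sub>R snd z))"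
          unfolding 1 by (rule continuous_b_compose) (use D(2) in \<open>force intro!: continuous_intros\<close>)+
        then have "continuous_map (top_of_set C) M (\<lambda>(c, v). X c (b v))"
          by (rule continuous_map_eq) (use D 1 in \<open>force simp: X_b\<close>)
        moreover have "subtopology (top_of_set ?E) C = top_of_set C"
          using 1 by (auto simp: subtopology_subtopology intro!: arg_cong[where f = top_of_set])
        ultimately show ?thesis by metis
      next
        case 2
        have "continuous_map (top_of_set ?E) euclidean snd" by (simp add: continuous_on_snd)
        from closedin_continuous_map_preimage[OF this, of "disc_cone i"]
        have cl: "closedin (top_of_set ?E) C"
          using compact_disc_cone[OF 2(1)] 2(2) by (simp add: compact_imp_closed)
        have C: "snd z \<in> disc_cone i" "1 \<le> ?p z" "z \<in> D" "snd z \<noteq> 0" if "z \<in> C" for z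
          using that 2 by auto
        let ?h = "\<lambda>z. hcoord (b (sgn (snd z)))"
        have "continuous_on C (\<lambda>z. sgn (snd z))"
          using C by (intro continuous_on_sgn continuous_on_snd continuous_on_id) auto
        moreover have "sgn (snd z) \<in> disc i" if "z \<in> C" for z
          using X_b_outside(1)[OF 2(1)] C[OF that] D[of z] by blast
        ultimately have "continuous_on C ?h"
          by (intro continuous_on_compose2[OF continuous_hcoord_disc[OF 2(1)]]) auto
        then have "continuous_on C (\<lambda>z. (?p z *\<^sub>R fst (?h z), snd (?h z) / ?p z))"
          using C by (intro continuous_intros) force+
        then have "continuous_map (top_of_set C) M (\<lambda>z. K i (?p z *\<^sub>R fst (?h z), snd (?h z) / ?p z))"
          by (rule continuous_K_compose[OF 2(1)]) (use X_b_outside(2)[OF 2(1)] C D in blast)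
        then have "continuous_map (top_of_set C) M (\<lambda>(c, v). X c (b v))"
        proof (rule continuous_map_eq)
          fix z assume "z \<in> topspace (top_of_set C)"
          then have "z \<in> C" by simp
          then show "K i (?p z *\<^sub>R fst (?h z), snd (?h z) / ?p z) = (case z of (c, v) \<Rightarrow> X c (b v))"
            using X_b_outside(3)[OF 2(1), of "snd z" "fst z"] C[of z] D[of z]
            by (simp add: case_prod_unfold)
        qed
        moreover have "subtopology (top_of_set ?E) C = top_of_set C"
          using 2 by (auto simp: subtopology_subtopology intro!: arg_cong[where f = top_of_set])
        ultimately show ?thesis using cl by simp
      qed
    qed
  qed
  then show ?thesis unfolding D_def .
qed

lemma continuous_X_handle:
  assumes i: "i < g"
  shows "continuous_map (top_of_set {(c, z). z \<in> cylinder \<and> (c, k i z) \<in> {(c, m). 0 < c \<and> c * lam m \<le> 1}})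
     M (\<lambda>(c, z). X c (k i z))"
proof -
  define D where "D = {(c, z). z \<in> cylinder \<and> (c, k i z) \<in> {(c, m). 0 < c \<and> c * lam m \<le> 1}}"
  have D: "(y, w) \<in> \<Omega> \<and> 0 < c \<and> c * norm y \<le> 1 \<and> k i (y, w) = K i (y, w)"
    if "(c, y, w) \<in> D" for c y w
    using that i by (auto simp: D_def \<Omega>_def lam_k K_le mult_le_one)
  have "continuous_map (top_of_set D) M (\<lambda>p. K i (fst p *\<^sub>R fst (snd p), snd (snd p) / fst p))"
  proof (rule continuous_K_compose[OF i])
    show "continuous_on D (\<lambda>p. (fst p *\<^sub>R fst (snd p), snd (snd p) / fst p))"
      using D by (intro continuous_intros) force
    show "(fst p *\<^sub>R fst (snd p), snd (snd p) / fst p) \<in> \<Omega>" if "p \<in> D" for p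
      using that D \<Omega>_scale by (cases p) force
  qed
  then have "continuous_map (top_of_set D) M (\<lambda>(c, z). X c (k i z))"
  proof (rule continuous_map_eq)
    fix p assume "p \<in> topspace (top_of_set D)"
    moreover obtain c y w where "p = (c, y, w)" by (cases p) auto
    ultimately show "K i (fst p *\<^sub>R fst (snd p), snd (snd p) / fst p) = (case p of (c, z) \<Rightarrow> X c (k i z))"
      using D[of c y w] X_K[OF i, of y w c] by simp
  qed
  then show ?thesis unfolding D_def .
qed

lemma continuous_X:
  "continuous_map (subtopology (prod_topology euclideanreal M) {(c, m). 0 < c \<and> c * lam m \<le> 1})
     M (\<lambda>(c, m). X c m)"
proof (rule continuous_map_closed_cover)
  let ?D = "{(c, m). 0 < c \<and> c * lam m \<le> 1}"
  let ?R = "prod_topology euclideanreal M"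
  let ?F = "insert (b ` cball 0 1) ((\<lambda>i. k i ` cylinder) ` {..<g})"
  let ?C = "(\<lambda>P. topspace (subtopology ?R ?D) \<inter> UNIV \<times> P) ` ?F"
  show "finite ?C" by simp
  show "topspace (subtopology ?R ?D) \<subseteq> \<Union> ?C" using topspace_eq by auto
  fix C assume "C \<in> ?C"
  then obtain P where P: "P \<in> ?F" "C = topspace (subtopology ?R ?D) \<inter> UNIV \<times> P" by blast
  have "closedin M P" using P(1) closedin_b_cball closedin_k_cylinder by auto
  then have "closedin ?R (UNIV \<times> P)" by (simp add: closedin_prod_Times_iff)
  then have "closedin (subtopology ?R ?D) (?D \<inter> UNIV \<times> P)"
    by (rule closedin_subtopology_Int_closed)
  moreover have C: "?D \<inter> UNIV \<times> P = C"
    unfolding P(2) using closedin_subset[OF \<open>closedin M P\<close>] by auto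
  ultimately have "closedin (subtopology ?R ?D) C" by simp
  moreover have "continuous_map (subtopology ?R (?D \<inter> UNIV \<times> P)) M (\<lambda>(c, m). X c m)"
  proof (cases "P = b ` cball 0 1")
    case True
    then show ?thesis
      using continuous_map_product_piece[OF compact_cball Hausdorff continuous_b inj_b continuous_X_ball] by simp
  next
    case False
    then obtain i where "i < g" "P = k i ` cylinder" using P(1) by blast
    then show ?thesis
      using continuous_map_product_piece[OF compact_cylinder Hausdorff continuous_k inj_k continuous_X_handle] by simp
  qed
  moreover have "subtopology (subtopology ?R ?D) C = subtopology ?R (?D \<inter> UNIV \<times> P)"
    unfolding subtopology_subtopology C[symmetric] by (simp add: Int_assoc[symmetric])
  ultimately show "closedin (subtopology ?R ?D) C \<and>
      continuous_map (subtopology (subtopology ?R ?D) C) M (\<lambda>(c, m). X c m)" by simp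
qed

sublocale collapse M lam X
  by unfold_locales (use continuous_lam lam_nonneg lam_le_1 continuous_X lam_X X_1 X_X in auto)

section \<open>The boundary and the equilibria\<close>

text \<open>Its image under \<open>K\<close> reaches across the attaching discs into the ball, so it
  supplies charts at points where ball and handle meet.\<close>

definition \<Omega>_inner :: "((real^2) \<times> real) set" where
  "\<Omega>_inner = {(y, w). norm y < 1 \<and> norm y * \<bar>w\<bar> < 1}"

lemma \<Omega>_inner_subset: "\<Omega>_inner \<subseteq> \<Omega>"
  by (auto simp: \<Omega>_inner_def \<Omega>_def)

lemma open_\<Omega>_inner: "open \<Omega>_inner"
proof -
  have "open {z :: (real^2) \<times> real. norm (fst z) < 1 \<and> norm (fst z) * \<bar>snd z\<bar> < 1}"
    by (intro open_Collect_conj open_Collect_less continuous_intros)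
  then show ?thesis by (simp add: \<Omega>_inner_def case_prod_unfold)
qed

lemma K_eq_k:
  assumes "i < g" "j < g" "z \<in> \<Omega>" "z' \<in> cylinder" "K i z = k j z'"
  shows "i = j \<and> z = z'"
proof -
  obtain y w y' w' where z: "z = (y, w)" "z' = (y', w')" by fastforce
  from assms(3)[unfolded z(1)] show ?thesis
  proof (cases rule: \<Omega>_cases)
    case inside
    then have eq: "k i z = k j z'" using assms(5) z by (simp add: K_le)
    have "z \<in> cylinder" using inside z by simp
    then have "i = j" using k_eqD[OF assms(1,2) _ assms(4) eq] by simp
    then show ?thesis using eq inj_onD[OF inj_k[OF assms(1)], of z z'] \<open>z \<in> cylinder\<close> assms(4) by simp
  next
    case (outside r x e)
    then show ?thesis
      using K_outside_notin_handles[OF assms(1), of r x e] k_handles[OF assms(2,4)] assms(5) z by simp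
  qed
qed

text \<open>In its own handle the image is seen as W itself, in the other handles as the empty set,
  and in the ball as two images under \<open>cone\<close>, one for each end, which are open by
  \<open>open_cone_image\<close>.\<close>

lemma openin_K_image:
  assumes "i < g" "open W" "W \<subseteq> \<Omega>_inner"
  shows "openin M (K i ` W)"
proof (rule openin_glue)
  have W: "W \<subseteq> \<Omega>" using assms(3) \<Omega>_inner_subset by blast
  then show "K i ` W \<subseteq> topspace M" using K_topspace[OF assms(1)] by blast
  show "openin (top_of_set cylinder) {z \<in> cylinder. k j z \<in> K i ` W}" if "j < g" for j
  proof (cases "j = i")
    case True
    have "{z \<in> cylinder. k i z \<in> K i ` W} = cylinder \<inter> W"
    proof (intro equalityI subsetI)
      fix z assume "z \<in> {z \<in> cylinder. k i z \<in> K i ` W}"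
      then obtain z' where z': "z \<in> cylinder" "z' \<in> W" "K i z' = k i z" by force
      then have "z' = z" using K_eq_k[OF assms(1) assms(1), of z' z] W by blast
      then show "z \<in> cylinder \<inter> W" using z' by simp
    next
      fix z assume z: "z \<in> cylinder \<inter> W"
      then have "k i z = K i z" by (cases z) (simp add: K_le)
      then show "z \<in> {z \<in> cylinder. k i z \<in> K i ` W}" using z by auto
    qed
    then show ?thesis using True assms(2) by (simp add: openin_open_Int)
  next
    case False
    then have "{z \<in> cylinder. k j z \<in> K i ` W} = {}"
      using K_eq_k[OF assms(1) that] W by fastforce
    then show ?thesis by (simp only: openin_empty)
  qed
  \<comment> \<open>\<open>?s e\<close> passes from cone coordinates (disc point, radius) at the end
    e to the coordinates of \<open>K\<close>.\<close>
  let ?D = "ball 0 1 \<times> {0<..} :: ((real^2) \<times> real) set"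
  let ?s = "\<lambda>e z. (snd z *\<^sub>R fst z, e / snd z)"
  let ?T = "\<lambda>e. {z \<in> ?D. ?s e z \<in> W}"
  have T: "open (?T e)" for e
  proof -
    have "continuous_on ?D (?s e)" by (intro continuous_intros) auto
    then have "open (?D \<inter> ?s e -` W)"
      by (rule continuous_open_preimage) (auto intro: open_Times assms(2))
    then show ?thesis by (simp add: vimage_def Int_def)
  qed
  have "open (cone i 1 ` ?T 1)" "open (cone i (-1) ` ?T (-1))"
    by (rule open_cone_image[OF assms(1) _ T]; auto)+
  then have "open (cone i 1 ` ?T 1 \<union> cone i (-1) ` ?T (-1))" by (rule open_Un)
  moreover have "{v \<in> cball 0 1. b v \<in> K i ` W} = cball 0 1 \<inter> (cone i 1 ` ?T 1 \<union> cone i (-1) ` ?T (-1))"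
  proof (intro equalityI subsetI)
    fix v assume "v \<in> {v \<in> cball 0 1. b v \<in> K i ` W}"
    then obtain y w where v: "norm v \<le> 1" "(y, w) \<in> W" "b v = K i (y, w)" by force
    have yw: "(y, w) \<in> \<Omega>" "norm y < 1" "norm y * \<bar>w\<bar> < 1"
      using v(2) assms(3) W by (auto simp: \<Omega>_inner_def)
    have "\<exists>x e r. norm x < 1 \<and> \<bar>e\<bar> = 1 \<and> 0 < r \<and> v = r *\<^sub>R att i (x, e) \<and> (r *\<^sub>R x, e / r) \<in> W"
      using yw(1)
    proof (cases rule: \<Omega>_cases)
      case inside
      then have bv: "b v = k i (y, w)" using v by (simp add: K_le)
      then have "\<bar>w\<bar> = 1" using meeting[OF assms(1) v(1) _ bv] inside by simp
      moreover have "v = att i (y, w)" using bv v(1) by (metis att_def binv_b)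
      ultimately show ?thesis using yw(2) v(2) by (intro exI[of _ y] exI[of _ w] exI[of _ 1]) simp
    next
      case (outside r x e)
      then have "v = r *\<^sub>R att i (x, e)" using v assms(1) by (simp add: K_att b_eq_iff)
      moreover have "norm x < 1" using yw(3) outside by simp
      ultimately show ?thesis using outside v(2) by blast
    qed
    then obtain x e r where *: "norm x < 1" "\<bar>e\<bar> = 1" "0 < r" "v = cone i e (x, r)" "(x, r) \<in> ?T e"
      by (auto simp: cone_def)
    then have "v \<in> cone i e ` ?T e" by blast
    moreover have "e = 1 \<or> e = -1" using *(2) by auto
    ultimately show "v \<in> cball 0 1 \<inter> (cone i 1 ` ?T 1 \<union> cone i (-1) ` ?T (-1))" using v(1) by auto
  next
    fix v assume v: "v \<in> cball 0 1 \<inter> (cone i 1 ` ?T 1 \<union> cone i (-1) ` ?T (-1))"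
    then obtain e z where e: "e = 1 \<or> e = -1" and z: "z \<in> ?T e" "v = cone i e z" by blast
    obtain x r where xr: "z = (x, r)" by fastforce
    have *: "norm x < 1" "0 < r" "\<bar>e\<bar> = 1" "v = r *\<^sub>R att i (x, e)" "(r *\<^sub>R x, e / r) \<in> W" "norm v \<le> 1"
      using z xr e v by (auto simp: cone_def)
    then have "norm v = r" using assms(1) by simp
    then have "b v = K i (r *\<^sub>R x, e / r)" using * assms(1) K_att[of i x e r] by simp
    then show "v \<in> {v \<in> cball 0 1. b v \<in> K i ` W}" using * by auto
  qed
  ultimately show "openin (top_of_set (cball 0 1)) {v \<in> cball 0 1. b v \<in> K i ` W}"
    by (simp add: openin_open_Int)
qed

lemma K_interior3:
  assumes "i < g"
  shows "K i ` \<Omega>_inner \<subseteq> interior3 M"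
proof (rule open_embedding_interior3)
  show "continuous_map (top_of_set \<Omega>_inner) M (K i)"
    by (rule continuous_map_from_subtopology_mono[OF continuous_K[OF assms] \<Omega>_inner_subset])
  show "inj_on (K i) \<Omega>_inner"
    using K_eqD[OF assms] \<Omega>_inner_subset by (intro inj_onI) blast
qed (use openin_K_image[OF assms] open_\<Omega>_inner in auto)

lemma openin_b_image:
  assumes "open W" "W \<subseteq> ball 0 1"
  shows "openin M (b ` W)"
proof (rule openin_glue)
  have W: "norm v < 1" if "v \<in> W" for v using that assms(2) by auto
  then show "b ` W \<subseteq> topspace M" using b_topspace by (meson image_subsetI less_imp_le)
  have "{v \<in> cball 0 1. b v \<in> b ` W} = cball 0 1 \<inter> W"
    using W by (auto simp: b_eq_iff less_imp_le)
  then show "openin (top_of_set (cball 0 1)) {v \<in> cball 0 1. b v \<in> b ` W}"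
    using assms(1) by (simp add: openin_open_Int)
  show "openin (top_of_set cylinder) {z \<in> cylinder. k i z \<in> b ` W}" if "i < g" for i
  proof -
    have "k i z \<notin> b ` W" if "z \<in> cylinder" for z
      using b_notin_handles W k_handles[OF \<open>i < g\<close> that] by force
    then have "{z \<in> cylinder. k i z \<in> b ` W} = {}" by blast
    then show ?thesis by (simp only: openin_empty)
  qed
qed

lemma b_interior3: "b ` ball 0 1 \<subseteq> interior3 M"
proof (rule open_embedding_interior3)
  show "continuous_map (top_of_set (ball 0 1)) M b"
    by (rule continuous_map_from_subtopology_mono[OF continuous_b ball_subset_cball])
  show "inj_on b (ball 0 1)" by (rule inj_on_subset[OF inj_b ball_subset_cball])
qed (use openin_b_image in auto)

text \<open>Handle points, those on attaching discs included, are covered by the chart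
  \<open>K\<close>. All others lie in the open ball, since on the sphere outside the handles
  \<open>lam\<close> is 1.\<close>

lemma lam_less_1_interior3:
  assumes "m \<in> topspace M" "lam m < 1"
  shows "m \<in> interior3 M"
proof (cases "m \<in> handles")
  case True
  then obtain i y w where *: "i < g" "norm y \<le> 1" "\<bar>w\<bar> \<le> 1" "m = k i (y, w)" by (rule handlesE)
  then have "norm y < 1" using assms lam_k[of i y w] by simp
  then have "(y, w) \<in> \<Omega>_inner"
    using *(3) mult_left_mono[of "\<bar>w\<bar>" 1 "norm y"] by (auto simp: \<Omega>_inner_def)
  then show ?thesis using K_interior3[OF *(1)] * by (auto simp: K_le[symmetric])
next
  case False
  then obtain v where v: "norm v \<le> 1" "m = b v" using assms by (auto simp: topspace_eq handles_def)
  have "norm v \<noteq> 1"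
  proof
    assume "norm v = 1"
    then have "lam m = 1" using v False by (simp add: lam_b lamS_def sgn_div_norm)
    then show False using assms by simp
  qed
  then show ?thesis using v b_interior3 by auto
qed

section \<open>Points of level 1 are boundary points\<close>

lemma interior_cylinder: "interior cylinder = ball 0 1 \<times> {-1<..<1}"
  by (simp add: cylinder_eq interior_Times)

lemma handle_side_notin_interior3:
  assumes "i < g" "norm y = 1" "\<bar>w\<bar> < 1"
  shows "k i (y, w) \<notin> interior3 M"
proof
  assume int: "k i (y, w) \<in> interior3 M"
  \<comment> \<open>An open set of M inside the single handle, so that invariance of domain can be
    applied in the handle's coordinates.\<close>
  let ?U = "topspace M - (b ` cball 0 1 \<union> (\<Union>j\<in>{..<g} - {i}. k j ` cylinder))"
  have z: "(y, w) \<in> cylinder" using assms by simp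
  have "closedin M (\<Union>j\<in>{..<g} - {i}. k j ` cylinder)"
    by (rule closedin_Union) (auto intro: closedin_k_cylinder)
  then have "openin M ?U" by (intro openin_diff closedin_Un closedin_b_cball) auto
  moreover have "?U \<subseteq> k i ` cylinder" unfolding topspace_eq by auto
  moreover have "k i (y, w) \<notin> b ` cball 0 1"
    using meeting[OF assms(1) _ z] assms(3) by fastforce
  then have "k i (y, w) \<in> ?U" using k_topspace[OF assms(1) z] k_eqD[OF assms(1) _ z] by blast
  ultimately have "(y, w) \<in> interior cylinder"
    using int z by (intro interior3_imp_interior[OF _ compact_cylinder Hausdorff continuous_k[OF assms(1)]
          inj_k[OF assms(1)], where W = ?U]) simp_all
  then show False using assms by (simp add: interior_cylinder)
qed

lemma lam_1_notin_interior3: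
  assumes "m \<in> topspace M" "lam m = 1"
  shows "m \<notin> interior3 M"
proof (cases "m \<in> handles")
  case True
  then obtain i y w where *: "i < g" "norm y \<le> 1" "\<bar>w\<bar> \<le> 1" "m = k i (y, w)" by (rule handlesE)
  then have y: "norm y = 1" using assms lam_k[of i y w] by simp
  show ?thesis
  proof (cases "\<bar>w\<bar> < 1")
    case True
    then show ?thesis using handle_side_notin_interior3 * y by blast
  next
    case False
    then have w: "\<bar>w\<bar> = 1" using * by simp
    show ?thesis
    proof
      assume "m \<in> interior3 M"
      \<comment> \<open>At the edge of an attaching disc no neighbourhood within one piece is at
        hand, so the previous argument is not repeated. Instead, \<open>interior3 M\<close> is open
        and would contain nearby points on the side of the handle, which has been excluded.\<close>
      have "openin (top_of_set cylinder) {z \<in> topspace (top_of_set cylinder). k i z \<in> interior3 M}"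
        by (rule openin_continuous_map_preimage[OF continuous_k[OF *(1)] openin_interior3])
      then obtain T where T: "open T" "{z \<in> cylinder. k i z \<in> interior3 M} = cylinder \<inter> T"
        by (auto simp: openin_open)
      then have "(y, w) \<in> T" using * \<open>m \<in> interior3 M\<close> by fastforce
      have "((\<lambda>n. (y, w * (1 - inverse (real (Suc n))))) \<longlonglongrightarrow> (y, w * (1 - 0)))"
        by (intro tendsto_intros LIMSEQ_inverse_real_of_nat)
      then have "eventually (\<lambda>n. (y, w * (1 - inverse (real (Suc n)))) \<in> T) sequentially"
        using topological_tendstoD[OF _ T(1)] \<open>(y, w) \<in> T\<close> by simp
      then obtain n where n: "(y, w * (1 - inverse (real (Suc n)))) \<in> T"
        by (auto simp: eventually_sequentially)
      have lt: "\<bar>w * (1 - inverse (real (Suc n)))\<bar> < 1"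
        using w by (simp add: abs_mult field_simps)
      then have "k i (y, w * (1 - inverse (real (Suc n)))) \<in> interior3 M"
        using T(2) n y by (metis (mono_tags, lifting) IntI cylinder_iff less_imp_le mem_Collect_eq order_refl)
      then show False using handle_side_notin_interior3[OF *(1) y lt] by simp
    qed
  qed
next
  case False
  then obtain v where v: "norm v \<le> 1" "m = b v" using assms by (auto simp: topspace_eq handles_def)
  show ?thesis
  proof
    assume "m \<in> interior3 M"
    moreover have "openin M (topspace M - handles)" using closedin_handles by blast
    moreover have "topspace M - handles \<subseteq> b ` cball 0 1" by (auto simp: topspace_eq handles_def)
    ultimately have "v \<in> interior (cball 0 1)"
      using v False assms(1)
      by (intro interior3_imp_interior[OF _ compact_cball Hausdorff continuous_b inj_b,
            where W = "topspace M - handles"]) simp_all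
    then have "norm v < 1" by simp
    then have "lam m < 1"
      using v by (cases "v = 0") (auto simp: lam_b norm_sgn
          intro!: le_less_trans[OF mult_left_le[OF lamS_le_1]])
    then show False using assms by simp
  qed
qed

lemma boundary3_eq: "boundary3 M = rim"
proof (intro equalityI subsetI)
  fix m assume "m \<in> boundary3 M"
  then have m: "m \<in> topspace M" "m \<notin> interior3 M" by (auto simp: boundary3_def)
  then have "\<not> lam m < 1" using lam_less_1_interior3 by blast
  then show "m \<in> rim" using m(1) lam_le_1[OF m(1)] by simp
next
  fix m assume "m \<in> rim"
  then show "m \<in> boundary3 M" using lam_1_notin_interior3[of m] by (simp add: boundary3_def)
qed

section \<open>Location of the equilibria and the extension theorem in coordinates\<close>

lemma center_interior3_ball: "b 0 \<in> interior3 (subtopology M (b ` cball 0 1))"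
proof -
  have "b ` ball 0 1 \<subseteq> interior3 (subtopology M (b ` cball 0 1))"
  proof (rule open_embedding_interior3)
    show "continuous_map (top_of_set (ball 0 1)) (subtopology M (b ` cball 0 1)) b"
      using continuous_map_from_subtopology_mono[OF continuous_b ball_subset_cball]
      by (auto simp: continuous_map_in_subtopology)
    show "inj_on b (ball 0 1)" by (rule inj_on_subset[OF inj_b ball_subset_cball])
    fix W :: "(real^3) set" assume W: "open W" "W \<subseteq> ball 0 1"
    then have "b ` W = b ` cball 0 1 \<inter> b ` W" by auto
    then show "openin (subtopology M (b ` cball 0 1)) (b ` W)"
      using openin_b_image[OF W] by (metis openin_subtopology_Int2)
  qed auto
  then show ?thesis by auto
qed

lemma center_interior3_handle:
  assumes "i < g"
  shows "k i (0, 0) \<in> interior3 (subtopology M (k i ` cylinder))"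
proof -
  let ?D = "ball 0 1 \<times> {-1<..<1} :: ((real^2) \<times> real) set"
  have D: "?D \<subseteq> cylinder" by (auto simp: cylinder_def)
  have D': "?D \<subseteq> \<Omega>_inner"
  proof clarify
    fix y :: "real^2" and w :: real assume "y \<in> ball 0 1" "w \<in> {-1<..<1}"
    then show "(y, w) \<in> \<Omega>_inner"
      using mult_left_mono[of "\<bar>w\<bar>" 1 "norm y"] by (auto simp: \<Omega>_inner_def abs_if split: if_splits)
  qed
  have "k i ` ?D \<subseteq> interior3 (subtopology M (k i ` cylinder))"
  proof (rule open_embedding_interior3)
    show "open ?D" by (intro open_Times) auto
    show "continuous_map (top_of_set ?D) (subtopology M (k i ` cylinder)) (k i)"
      using continuous_map_from_subtopology_mono[OF continuous_k[OF assms] D] D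
      by (auto simp: continuous_map_in_subtopology)
    show "inj_on (k i) ?D" by (rule inj_on_subset[OF inj_k[OF assms] D])
    fix W :: "((real^2) \<times> real) set" assume W: "open W" "W \<subseteq> ?D"
    have "k i z = K i z" if "z \<in> W" for z
      using W(2) D that by (cases z) (auto simp: K_def subset_iff)
    then have "k i ` W = K i ` W" by simp
    moreover have "openin M (K i ` W)" using openin_K_image[OF assms W(1)] W(2) D' by blast
    moreover have "k i ` W = k i ` cylinder \<inter> k i ` W" using W(2) D by blast
    ultimately show "openin (subtopology M (k i ` cylinder)) (k i ` W)"
      by (metis openin_subtopology_Int2)
  qed auto
  then show ?thesis by auto
qed

lemma interior3_subset: "interior3 (subtopology M A) \<subseteq> A"
  by (auto simp: interior3_def)

theorem extend_flow_handlebody: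
  assumes "flow_on (subtopology M (boundary3 M)) \<phi>"
  obtains \<Phi> where "flow_on M \<Phi>" "\<And>t. \<Phi> t ` boundary3 M = boundary3 M"
    "\<And>t x. x \<in> boundary3 M \<Longrightarrow> \<Phi> t x = \<phi> t x"
    "card (equilibria M \<Phi> - boundary3 M) = g + 1"
    "\<exists>!x. x \<in> equilibria M \<Phi> - boundary3 M \<and> x \<in> interior3 (subtopology M (b ` cball 0 1))"
    "\<And>i. i < g \<Longrightarrow> \<exists>!x. x \<in> equilibria M \<Phi> - boundary3 M \<and> x \<in> interior3 (subtopology M (k i ` cylinder))"
proof -
  obtain \<Phi> where \<Phi>: "flow_on M \<Phi>" "\<And>t x. x \<in> rim \<Longrightarrow> \<Phi> t x = \<phi> t x"
    "equilibria M \<Phi> - rim = {m \<in> topspace M. lam m = 0 \<and> (\<forall>c>0. X c m = m)}"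
    using extend_flow assms unfolding boundary3_eq by blast
  let ?c = "\<lambda>i. k i (0, 0)"
  have "equilibria M \<Phi> - rim = insert (b 0) (?c ` {..<g})"
    unfolding \<Phi>(3) using fixed_iff b_topspace[of 0] k_topspace[of _ "(0, 0)"] by auto
  then have eq: "equilibria M \<Phi> - boundary3 M = insert (b 0) (?c ` {..<g})"
    by (simp add: boundary3_eq)
  have center: "b 0 \<notin> k i ` cylinder" if "i < g" for i
    using b_notin_handles[of 0] that by (auto simp: handles_def)
  have c_ball: "?c i \<notin> b ` cball 0 1" if "i < g" for i
    using meeting[OF that, of _ 0 0] by fastforce
  have c_eq: "i = j" if "i < g" "j < g" "?c i \<in> k j ` cylinder" for i j
    using that k_eqD[OF that(1,2), of "(0, 0)"] by auto
  have "inj_on ?c {..<g}"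
    by (rule inj_onI) (use k_eqD in \<open>simp add: k_eqD[of _ _ "(0, 0)" "(0, 0)"]\<close>)
  then have "card (?c ` {..<g}) = g" by (simp add: card_image)
  moreover have "b 0 \<notin> ?c ` {..<g}"
  proof
    assume "b 0 \<in> ?c ` {..<g}"
    then obtain i where "i < g" "?c i = b 0" by auto
    moreover have "b 0 \<in> b ` cball 0 1" by (intro imageI) simp
    ultimately show False using c_ball[of i] by simp
  qed
  ultimately have "card (equilibria M \<Phi> - boundary3 M) = g + 1" unfolding eq by simp
  \<comment> \<open>The interior of a piece lies in the piece, so uniqueness only needs that the
    centres of the other pieces lie outside it.\<close>
  moreover have "\<exists>!x. x \<in> equilibria M \<Phi> - boundary3 M \<and> x \<in> interior3 (subtopology M (b ` cball 0 1))"
    unfolding eq using center_interior3_ball interior3_subset[of "b ` cball 0 1"] c_ball by blast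
  moreover have "\<exists>!x. x \<in> equilibria M \<Phi> - boundary3 M \<and> x \<in> interior3 (subtopology M (k i ` cylinder))"
    if "i < g" for i
    unfolding eq using center_interior3_handle[OF that] interior3_subset[of "k i ` cylinder"]
      center[OF that] c_eq[OF _ that] that by blast
  moreover have "\<Phi> t ` boundary3 M = boundary3 M" for t
  proof -
    have "\<phi> t ` boundary3 M = boundary3 M"
      using flow_on_image[OF assms] by (simp add: boundary3_def Int_absorb1)
    then show ?thesis using \<Phi>(2) by (simp add: boundary3_eq)
  qed
  ultimately show ?thesis using that \<Phi>(1,2) boundary3_eq by blast
qed

end

section \<open>From the definition of a handlebody to coordinates\<close>

lemma handlebody_attached_handles:
  assumes "handlebody M g B H"
  obtains b k where "attached_handles M g b k" "b ` cball 0 1 = B"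
    "\<And>i. i < g \<Longrightarrow> k i ` cylinder = H i"
proof -
  have M: "Hausdorff_space M" "B \<subseteq> topspace M" "\<And>i. i < g \<Longrightarrow> H i \<subseteq> topspace M"
      "topspace M = B \<union> (\<Union>i<g. H i)" "disjoint_family_on H {..<g}"
      "subtopology M B homeomorphic_space top_of_set (cball (0::real^3) 1)"
    using assms by (auto simp: handlebody_def manifold3_with_boundary_def)
  then obtain b where b: "homeomorphic_map (top_of_set (cball (0::real^3) 1)) (subtopology M B) b"
    using homeomorphic_space homeomorphic_space_sym by blast
  have cb: "continuous_map (top_of_set (cball 0 1)) (subtopology M B) b"
    and ib: "inj_on b (cball 0 1)" and bB: "b ` cball 0 1 = B"
    using homeomorphic_imp_continuous_map[OF b] homeomorphic_imp_injective_map[OF b]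
      homeomorphic_imp_surjective_map[OF b] M(2) by (simp_all add: Int_absorb1)
  \<comment> \<open>The definition only puts the attaching discs into \<open>boundary3\<close> of B.
    Since the open ball consists of interior points, they must come from the unit sphere.\<close>
  have "b ` ball 0 1 \<subseteq> interior3 (subtopology M B)"
  proof (rule open_embedding_interior3)
    show "continuous_map (top_of_set (ball 0 1)) (subtopology M B) b"
      by (rule continuous_map_from_subtopology_mono[OF cb ball_subset_cball])
    show "inj_on b (ball 0 1)" by (rule inj_on_subset[OF ib ball_subset_cball])
    fix W :: "(real^3) set" assume W: "open W" "W \<subseteq> ball 0 1"
    then have "openin (top_of_set (cball 0 1)) W" by (meson ball_subset_cball open_subset subset_trans)
    then show "openin (subtopology M B) (b ` W)"
      using homeomorphic_imp_open_map[OF b] by (simp add: open_map_def)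
  qed auto
  then have int: "b v \<in> interior3 (subtopology M B)" if "norm v < 1" for v using that by auto
  have "\<forall>i\<in>{..<g}. \<exists>h. homeomorphic_map
          (top_of_set (cball (0::real^2) 1 \<times> {0..1::real})) (subtopology M (H i)) h \<and>
        B \<inter> H i = h ` (cball 0 1 \<times> {0, 1}) \<and> B \<inter> H i \<subseteq> boundary3 (subtopology M B)"
    using assms by (simp add: handlebody_def)
  then obtain h where h: "\<And>i. i < g \<Longrightarrow> homeomorphic_map
          (top_of_set (cball (0::real^2) 1 \<times> {0..1::real})) (subtopology M (H i)) (h i)"
      "\<And>i. i < g \<Longrightarrow> B \<inter> H i = h i ` (cball 0 1 \<times> {0, 1})"
      "\<And>i. i < g \<Longrightarrow> B \<inter> H i \<subseteq> boundary3 (subtopology M B)"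
    by (metis lessThan_iff)
  \<comment> \<open>The affine change of the core parameter from [-1, 1] to the interval [0, 1] used
    by \<open>handlebody\<close>.\<close>
  define s :: "(real^2) \<times> real \<Rightarrow> (real^2) \<times> real" where "s = (\<lambda>z. (fst z, (snd z + 1) / 2))"
  have s: "homeomorphism cylinder (cball 0 1 \<times> {0..1}) s (\<lambda>z. (fst z, 2 * snd z - 1))"
    unfolding s_def cylinder_eq
    by (rule homeomorphismI) (auto intro!: continuous_intros simp: field_simps)
  then have s_img: "s ` cylinder = cball 0 1 \<times> {0..1}" and s_cont: "continuous_on cylinder s"
    by (auto simp: homeomorphism_def)
  have s_inj: "inj_on s cylinder" by (rule inj_onI) (auto simp: s_def prod_eq_iff)
  define k where "k = (\<lambda>i z. h i (s z))"
  have hc: "continuous_map (top_of_set (cball 0 1 \<times> {0..1})) M (h i)"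
    and hi: "inj_on (h i) (cball 0 1 \<times> {0..1})" and hH: "h i ` (cball 0 1 \<times> {0..1}) = H i"
    if "i < g" for i
    using homeomorphic_imp_continuous_map[OF h(1)[OF that]] homeomorphic_imp_injective_map[OF h(1)[OF that]]
      homeomorphic_imp_surjective_map[OF h(1)[OF that]] M(3)[OF that]
    by (auto simp: continuous_map_in_subtopology)
  have kH: "k i ` cylinder = H i" if "i < g" for i
    using hH[OF that] unfolding k_def s_img[symmetric] image_image .
  have "attached_handles M g b k"
  proof
    show "Hausdorff_space M" by (rule M(1))
    show "continuous_map (top_of_set (cball 0 1)) M b" using cb by (simp add: continuous_map_in_subtopology)
    show "inj_on b (cball 0 1)" by (rule ib)
    show "continuous_map (top_of_set cylinder) M (k i)" if "i < g" for i
      unfolding k_def by (rule continuous_map_compose_top_of_set[OF hc[OF that] s_cont]) (simp add: s_img)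
    show "inj_on (k i) cylinder" if "i < g" for i
      unfolding k_def using comp_inj_on[OF s_inj] hi[OF that] s_img by (simp add: o_def)
    show "topspace M = b ` cball 0 1 \<union> (\<Union>i<g. k i ` cylinder)" using M(4) bB kH by simp
    show "i = j" if "i < g" "j < g" "z \<in> cylinder" "z' \<in> cylinder" "k i z = k j z'" for i j z z'
    proof (rule ccontr)
      assume "i \<noteq> j"
      then have "H i \<inter> H j = {}" using M(5) that by (auto simp: disjoint_family_on_def)
      moreover have "k i z \<in> H i" "k i z \<in> H j" using kH that by (blast, metis imageI)
      ultimately show False by blast
    qed
    show "k i (y, e) \<in> b ` sphere 0 1" if "i < g" "norm y \<le> 1" "\<bar>e\<bar> = 1" for i y e
    proof -
      have "s (y, e) \<in> cball 0 1 \<times> {0, 1}" using that by (auto simp: s_def abs_if split: if_splits)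
      then have *: "k i (y, e) \<in> B \<inter> H i" unfolding k_def h(2)[OF that(1)] by (rule imageI)
      then obtain v where v: "norm v \<le> 1" "k i (y, e) = b v" using bB by auto
      have "b v \<notin> interior3 (subtopology M B)"
        using * v h(3)[OF that(1)] by (auto simp: boundary3_def)
      then have "norm v = 1" using int[of v] v(1) by fastforce
      then show ?thesis using v by auto
    qed
    show "\<bar>w\<bar> = 1" if "i < g" "norm v \<le> 1" "(y, w) \<in> cylinder" "b v = k i (y, w)" for i v y w
    proof -
      have "k i (y, w) \<in> B" using that(2,4) bB by force
      moreover have "k i (y, w) \<in> H i" using kH[OF that(1)] that(3) by blast
      ultimately have "h i (s (y, w)) \<in> h i ` (cball 0 1 \<times> {0, 1})" using h(2)[OF that(1)] by (auto simp: k_def)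
      then obtain p where p: "p \<in> cball 0 1 \<times> {0, 1}" "h i (s (y, w)) = h i p" by blast
      have "s (y, w) \<in> cball 0 1 \<times> {0..1}" using that(3) s_img by blast
      then have "s (y, w) = p" using inj_onD[OF hi[OF that(1)] p(2)] p(1) by auto
      then show ?thesis using p(1) by (auto simp: s_def)
    qed
  qed
  then show ?thesis using that bB kH by blast
qed

theorem theorem3p1:
  fixes M :: "'a topology" and g :: nat and B S :: "'a set" and H :: "nat \<Rightarrow> 'a set"
    and \<phi> :: "real \<Rightarrow> 'a \<Rightarrow> 'a"
  assumes "handlebody M g B H"
    and "S = boundary3 M"
    and "flow_on (subtopology M S) \<phi>"
  shows "\<exists>\<Phi>. flow_on M \<Phi> \<and>
      (\<forall>t. \<Phi> t ` S = S) \<and>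
      (\<forall>t. \<forall>x \<in> S. \<Phi> t x = \<phi> t x) \<and>
      card (equilibria M \<Phi> - S) = g + 1 \<and>
      (\<exists>!x. x \<in> equilibria M \<Phi> - S \<and> x \<in> interior3 (subtopology M B)) \<and>
      (\<forall>i<g. \<exists>!x. x \<in> equilibria M \<Phi> - S \<and> x \<in> interior3 (subtopology M (H i)))"
proof -
  obtain b k where bk: "attached_handles M g b k" "b ` cball 0 1 = B"
    "\<And>i. i < g \<Longrightarrow> k i ` cylinder = H i"
    using handlebody_attached_handles[OF assms(1)] by blast
  interpret attached_handles M g b k by (rule bk(1))
  obtain \<Phi> where "flow_on M \<Phi>" "\<And>t. \<Phi> t ` boundary3 M = boundary3 M"
    "\<And>t x. x \<in> boundary3 M \<Longrightarrow> \<Phi> t x = \<phi> t x"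
    "card (equilibria M \<Phi> - boundary3 M) = g + 1"
    "\<exists>!x. x \<in> equilibria M \<Phi> - boundary3 M \<and> x \<in> interior3 (subtopology M (b ` cball 0 1))"
    "\<And>i. i < g \<Longrightarrow> \<exists>!x. x \<in> equilibria M \<Phi> - boundary3 M \<and> x \<in> interior3 (subtopology M (k i ` cylinder))"
    using extend_flow_handlebody assms(2,3) by blast
  then show ?thesis using bk(2,3) assms(2) by (intro exI[of _ \<Phi>]) simp
qed

end
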